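(* Let $\mathcal P\subset\mathbb Q[x_1,\dots,x_n]$ be a zero-dimensional polynomial system, and let the positive rational numbers $d_1,\dots,d_n$, $r_1,\dots,r_n$, $s_1,\dots,s_{n-1}$ satisfy conditions (C1), (C2), (C3) below. Let $T_1,\dots,T_n$ be the univariate polynomials defined below. Then $(T_1,\dots,T_n,\ s_1,\dots,s_{n-1},\ d_1,\dots,d_{n-1})$ is a linear univariate representation (LUR) for $\mathcal P$, i.e. the set of roots of this LUR equals $V_{\mathbb C}(\mathcal P)$.
   Context: Standing setup. $\mathcal P=\{f_1,\dots,f_s\}\subset\mathbb Q[x_1,\dots,x_n]$ is zero-dimensional (finitely many common complex zeros). For $i=1,\dots,n$ let $\mathcal I_i=(\mathcal P)\cap\mathbb Q[x_1,\dots,x_i]$ and let $V_{\mathbb C}(\mathcal I_i)\subset\mathbb C^i$ be its set of common complex zeros; $V_{\mathbb C}(\mathcal I_0)$ consists of the single empty tuple. Throughout, for a complex number $c=u+v\mathrm{i}$ ($u,v\in\mathbb R$) we use the norm $|c|=\max\{|u|,|v|\}$. Put $s_0=1$, $d_0=+\infty$. For $i=1,\dots,n$ let $D_i=\min\{\tfrac12|\alpha-\beta| : \eta\in V_{\mathbb C}(\mathcal I_{i-1}),\ (\eta,\alpha),(\eta,\beta)\in V_{\mathbb C}(\mathcal I_i),\ \alpha\neq\beta\}$ (with $D_i=+\infty$ if this set is empty). Conditions: (C1) $d_i<\min\{D_i,\ d_{i-1}/(2s_{i-1})\}$ for $i=1,\dots,n$; (C2) $r_i>2\max\{|\alpha_i|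 : (\alpha_1,\dots,\alpha_i)\in V_{\mathbb C}(\mathcal I_i)\}$ for $i=1,\dots,n$; (C3) $s_i\le d_i/r_{i+1}$ for $i=1,\dots,n-1$. For $i=1,\dots,n$, $T_i(x)\in\mathbb Q[x]$ is a generator of the principal ideal $\big(\mathcal I_i\cup\{x-x_1-s_1x_2-\cdots-s_1\cdots s_{i-1}x_i\}\big)\cap\mathbb Q[x]$, the ideal being taken in $\mathbb Q[x_1,\dots,x_i,x]$ with $x$ a new variable. An LUR is a tuple $(T_1,\dots,T_n,\ s_1,\dots,s_{n-1},\ d_1,\dots,d_{n-1})$ with $T_i\in\mathbb Q[x]$ and $s_i,d_i$ positive rationals; its roots are the points $\big(\alpha_1,\frac{\alpha_2-\alpha_1}{s_1},\dots,\frac{\alpha_n-\alpha_{n-1}}{s_1\cdots s_{n-1}}\big)$ where $T_i(\alpha_i)=0$ for $i=1,\dots,n$ and $|\alpha_{i+1}-\alpha_i|<s_1\cdots s_{i-1}d_i$ for $i=1,\dots,n-1$. It is an LUR for $\mathcal P$ if its set of roots equals $V_{\mathbb C}(\mathcal P)$. *)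

theory Defs
  imports Complex_Main "HOL-Library.Poly_Mapping" "HOL-Computational_Algebra.Polynomial"
begin

text \<open>Multivariate polynomials over Q: finitely supported maps from monomials
(exponent vectors, variable index \<Rightarrow> exponent) to rational coefficients.
Variable x_(j+1) of the paper is index j (0-based); the auxiliary variable x
of the elimination is index n.\<close>

type_synonym mpoly = "(nat \<Rightarrow>\<^sub>0 nat) \<Rightarrow>\<^sub>0 rat"

definition mvars :: "mpoly \<Rightarrow> nat set" where
  "mvars p = (\<Union>m\<in>Poly_Mapping.keys p. Poly_Mapping.keys m)"

definition meval :: "mpoly \<Rightarrow> complex list \<Rightarrow> complex" where
  "meval p xs = (\<Sum>m\<in>Poly_Mapping.keys p.
      of_rat (Poly_Mapping.lookup p m) *
      (\<Prod>j\<in>Poly_Mapping.keys m. (xs ! j) ^ Poly_Mapping.lookup m j))"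

definition ideal_in :: "nat set \<Rightarrow> mpoly set \<Rightarrow> mpoly set" where
  "ideal_in V S = {p. \<exists>F c. finite F \<and> F \<subseteq> S \<and> (\<forall>f\<in>F. mvars (c f) \<subseteq> V)
                         \<and> p = (\<Sum>f\<in>F. c f * f)}"

definition elim_ideal :: "mpoly set \<Rightarrow> nat \<Rightarrow> nat \<Rightarrow> mpoly set" where
  "elim_ideal P n i = ideal_in {..<n} P \<inter> {p. mvars p \<subseteq> {..<i}}"

definition zeros_in :: "nat \<Rightarrow> mpoly set \<Rightarrow> complex list set" where
  "zeros_in i S = {xs. length xs = i \<and> (\<forall>f\<in>S. meval f xs = 0)}"

definition mvar :: "nat \<Rightarrow> mpoly" where
  "mvar j = Poly_Mapping.single (Poly_Mapping.single j 1) 1"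

definition mconst :: "rat \<Rightarrow> mpoly" where
  "mconst c = Poly_Mapping.single 0 c"

definition univ_embed :: "nat \<Rightarrow> rat poly \<Rightarrow> mpoly" where
  "univ_embed v q = (\<Sum>k\<le>degree q. Poly_Mapping.single (Poly_Mapping.single v k) (coeff q k))"

definition lin_form :: "(nat \<Rightarrow> rat) \<Rightarrow> nat \<Rightarrow> nat \<Rightarrow> mpoly" where
  "lin_form s n i = mvar n - (\<Sum>j<i. mconst (\<Prod>k\<in>{1..j}. s k) * mvar j)"

definition is_T :: "mpoly set \<Rightarrow> nat \<Rightarrow> (nat \<Rightarrow> rat) \<Rightarrow> nat \<Rightarrow> rat poly \<Rightarrow> bool" where
  "is_T P n s i T \<longleftrightarrow>
     (\<forall>q. univ_embed n q \<in> ideal_in (insert n {..<i}) (elim_ideal P n i \<union> {lin_form s n i})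
           \<longleftrightarrow> T dvd q)"

definition cnorm :: "complex \<Rightarrow> real" where
  "cnorm c = max \<bar>Re c\<bar> \<bar>Im c\<bar>"

definition lur_roots :: "nat \<Rightarrow> (nat \<Rightarrow> rat poly) \<Rightarrow> (nat \<Rightarrow> rat) \<Rightarrow> (nat \<Rightarrow> rat) \<Rightarrow> complex list set" where
  "lur_roots n T s d =
     {map (\<lambda>k. if k = 0 then \<alpha> 1
               else (\<alpha> (k + 1) - \<alpha> k) / of_rat (\<Prod>j\<in>{1..k}. s j)) [0..<n]
      | \<alpha>. (\<forall>i\<in>{1..n}. poly (map_poly of_rat (T i)) (\<alpha> i) = 0) \<and>
           (\<forall>i\<in>{1..n-1}. cnorm (\<alpha> (i + 1) - \<alpha> i) < of_rat ((\<Prod>j\<in>{1..i-1}. s j) * d i))}"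

end

theory Submission
  imports Defs "HOL-Computational_Algebra.Fundamental_Theorem_Algebra"
    "HOL-Analysis.Continuum_Not_Denumerable"
begin

text \<open>The algebraic half is that the roots of \<open>T\<^sub>i\<close> are exactly the values of
  \<open>x\<^sub>1 + s\<^sub>1 x\<^sub>2 + \<dots> + s\<^sub>1 \<cdots> s\<^bsub>i-1\<^esub> x\<^sub>i\<close> on the zero set of the \<open>i\<close>-th elimination
  ideal. Instead of the Nullstellensatz it uses that every prime ideal of a polynomial ring over
  the rationals in finitely many variables is the vanishing ideal of some complex point: the
  coordinates are chosen one at a time, and a transcendental choice is always available because
  the ring is countable and the complex numbers are not. Hence an ideal whose zeros have only
  countably many \<open>v\<close>-coordinates contains a nonzero polynomial in the variable \<open>v\<close> alone.

  The metric half: put \<open>E\<^sub>i = s\<^sub>1 \<cdots> s\<^bsub>i-1\<^esub> d\<^sub>i\<close>, so that \<open>E\<^bsub>i+1\<^esub> < E\<^sub>i / 2\<close>. By induction on \<open>i\<close>,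
  distinct zeros of the \<open>i\<close>-th elimination ideal give values more than \<open>2 E\<^sub>i\<close> apart, while
  passing from a zero to an extension of it moves the value by less than \<open>E\<^sub>i / 2\<close>. So if
  consecutive roots differ by less than \<open>E\<^sub>i\<close>, the zeros they come from extend each other,
  since \<open>E\<^sub>i + E\<^sub>i / 2 < 2 E\<^sub>i\<close>.\<close>

section \<open>Prime ideals of subrings\<close>

text \<open>All polynomial rings in question are subsets of the one type \<open>mpoly\<close>, so
  subrings, ideals and primes are carried as sets relative to an ambient \<open>A\<close>.\<close>

definition is_subring :: "'a::comm_ring_1 set \<Rightarrow> bool" where
  "is_subring A \<longleftrightarrow> 0 \<in> A \<and> 1 \<in> A \<and> (\<forall>a\<in>A. - a \<in> A) \<and>
     (\<forall>a\<in>A. \<forall>b\<in>A. a + b \<in> A \<and> a * b \<in> A)"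

definition ideal_on :: "'a::comm_ring_1 set \<Rightarrow> 'a set \<Rightarrow> bool" where
  "ideal_on A I \<longleftrightarrow> I \<subseteq> A \<and> 0 \<in> I \<and>
     (\<forall>a\<in>I. \<forall>b\<in>I. a + b \<in> I) \<and> (\<forall>a\<in>A. \<forall>b\<in>I. a * b \<in> I)"

definition prime_on :: "'a::comm_ring_1 set \<Rightarrow> 'a set \<Rightarrow> bool" where
  "prime_on A M \<longleftrightarrow> ideal_on A M \<and> 1 \<notin> M \<and>
     (\<forall>a\<in>A. \<forall>b\<in>A. a * b \<in> M \<longrightarrow> a \<in> M \<or> b \<in> M)"

lemma subringD:
  assumes "is_subring A"
  shows "0 \<in> A" "1 \<in> A" "a \<in> A \<Longrightarrow> - a \<in> A" "a \<in> A \<Longrightarrow> b \<in> A \<Longrightarrow> a + b \<in> A"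
    "a \<in> A \<Longrightarrow> b \<in> A \<Longrightarrow> a * b \<in> A" "a \<in> A \<Longrightarrow> b \<in> A \<Longrightarrow> a - b \<in> A"
  using assms unfolding is_subring_def by (auto, metis diff_conv_add_uminus)

lemma subring_power: "is_subring A \<Longrightarrow> a \<in> A \<Longrightarrow> a ^ k \<in> A"
  by (induction k) (auto intro: subringD)

lemma subring_sum: "is_subring A \<Longrightarrow> (\<And>i. i \<in> X \<Longrightarrow> f i \<in> A) \<Longrightarrow> sum f X \<in> A"
  by (induction X rule: infinite_finite_induct) (auto intro: subringD)

lemma idealD:
  assumes "ideal_on A I"
  shows "a \<in> I \<Longrightarrow> a \<in> A" "0 \<in> I" "a \<in> I \<Longrightarrow> b \<in> I \<Longrightarrow> a + b \<in> I"
    "a \<in> A \<Longrightarrow> b \<in> I \<Longrightarrow> a * b \<in> I" "a \<in> A \<Longrightarrow> b \<in> I \<Longrightarrow> b * a \<in> I"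
  using assms unfolding ideal_on_def by (auto simp: mult.commute)

lemma ideal_diff:
  assumes "is_subring A" "ideal_on A I" "a \<in> I" "b \<in> I"
  shows "a - b \<in> I"
proof -
  have "(- 1) * b \<in> I"
    using assms by (intro idealD(4)[OF assms(2)] subringD(2,3)) auto
  then have "a + (- 1) * b \<in> I" using assms idealD(3) by blast
  then show ?thesis by simp
qed

lemma ideal_sum: "ideal_on A I \<Longrightarrow> (\<And>i. i \<in> X \<Longrightarrow> f i \<in> I) \<Longrightarrow> sum f X \<in> I"
  by (induction X rule: infinite_finite_induct) (auto intro: idealD)

lemma primeD:
  assumes "prime_on A M"
  shows "ideal_on A M" "1 \<notin> M" "a \<in> A \<Longrightarrow> b \<in> A \<Longrightarrow> a * b \<in> M \<Longrightarrow> a \<in> M \<or> b \<in> M"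
  using assms unfolding prime_on_def by auto

lemma prime_power:
  assumes "is_subring A" "prime_on A M" "a \<in> A" "a ^ k \<in> M"
  shows "a \<in> M"
  using assms(4)
proof (induction k)
  case 0
  then show ?case using primeD(2)[OF assms(2)] by simp
next
  case (Suc k)
  then show ?case
    using primeD(3)[OF assms(2,3) subring_power[OF assms(1,3)], of k] by auto
qed

text \<open>Krull's argument: an ideal that is maximal among those containing \<open>I\<close> and
  avoiding the multiplicative set \<open>S\<close> is prime.\<close>

lemma prime_ideal_disjoint:
  fixes A :: "'a::comm_ring_1 set"
  assumes A: "is_subring A" and I: "ideal_on A I"
    and S: "S \<subseteq> A" "1 \<in> S" "\<And>a b. a \<in> S \<Longrightarrow> b \<in> S \<Longrightarrow> a * b \<in> S"
    and dis: "I \<inter> S = {}"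
  obtains M where "prime_on A M" "I \<subseteq> M" "M \<inter> S = {}"
proof -
  define C where "C = {J. ideal_on A J \<and> I \<subseteq> J \<and> J \<inter> S = {}}"
  have "\<exists>M\<in>C. \<forall>X\<in>C. M \<subseteq> X \<longrightarrow> X = M"
  proof (rule subset_Zorn_nonempty)
    show "C \<noteq> {}" using I dis unfolding C_def by auto
    fix c assume c: "c \<noteq> {}" "subset.chain C c"
    then have cC: "\<And>J. J \<in> c \<Longrightarrow> J \<in> C" and
      lin: "\<And>J K. J \<in> c \<Longrightarrow> K \<in> c \<Longrightarrow> J \<subseteq> K \<or> K \<subseteq> J"
      by (auto simp: subset_chain_def)
    have "ideal_on A (\<Union>c)"
      unfolding ideal_on_def
    proof (intro conjI ballI)
      show "\<Union>c \<subseteq> A" using cC unfolding C_def ideal_on_def by blast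
      show "0 \<in> \<Union>c" using cC c(1) unfolding C_def ideal_on_def by blast
    next
      fix a b assume "a \<in> \<Union>c" "b \<in> \<Union>c"
      then obtain J K where JK: "J \<in> c" "K \<in> c" "a \<in> J" "b \<in> K" by auto
      have "J \<subseteq> K \<or> K \<subseteq> J" using lin JK by auto
      then have "a + b \<in> K \<or> a + b \<in> J"
        using JK cC unfolding C_def ideal_on_def by blast
      then show "a + b \<in> \<Union>c" using JK by auto
    next
      fix a b assume "a \<in> A" "b \<in> \<Union>c"
      then show "a * b \<in> \<Union>c" using cC unfolding C_def ideal_on_def by blast
    qed
    moreover have "I \<subseteq> \<Union>c" using cC c(1) unfolding C_def by blast
    moreover have "\<Union>c \<inter> S = {}" using cC unfolding C_def by blast
    ultimately show "\<Union>c \<in> C" unfolding C_def by auto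
  qed
  then obtain M where M: "M \<in> C" and max: "\<And>X. X \<in> C \<Longrightarrow> M \<subseteq> X \<Longrightarrow> X = M" by blast
  have idM: "ideal_on A M" and IM: "I \<subseteq> M" and MS: "M \<inter> S = {}"
    using M unfolding C_def by auto
  \<comment> \<open>By maximality, the ideal generated by \<open>M\<close> and an element outside
    \<open>M\<close> can no longer avoid \<open>S\<close>.\<close>
  have meets: "\<exists>m\<in>M. \<exists>b\<in>A. m + b * a \<in> S" if a: "a \<in> A" "a \<notin> M" for a
  proof (rule ccontr)
    assume no: "\<not> ?thesis"
    define X where "X = {m + b * a |m b. m \<in> M \<and> b \<in> A}"
    have "ideal_on A X"
      unfolding ideal_on_def
    proof (intro conjI ballI)
      show "X \<subseteq> A" unfolding X_def using a A idealD(1)[OF idM] by (auto intro!: subringD)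
      have "0 + 0 * a \<in> X" unfolding X_def using idealD(2)[OF idM] subringD(1)[OF A] by blast
      then show "0 \<in> X" by simp
    next
      fix x y assume "x \<in> X" "y \<in> X"
      then obtain m b m' b' where *: "x = m + b * a" "y = m' + b' * a" "m \<in> M" "m' \<in> M"
        "b \<in> A" "b' \<in> A" unfolding X_def by auto
      then have "x + y = (m + m') + (b + b') * a" by (simp add: algebra_simps)
      then show "x + y \<in> X" unfolding X_def using * idealD(3)[OF idM] subringD(4)[OF A] by blast
    next
      fix x y assume "x \<in> A" "y \<in> X"
      then obtain m b where *: "y = m + b * a" "m \<in> M" "b \<in> A" unfolding X_def by auto
      then have "x * y = x * m + (x * b) * a" by (simp add: algebra_simps)
      then show "x * y \<in> X"
        unfolding X_def using * \<open>x \<in> A\<close> idealD(4)[OF idM] subringD(5)[OF A] by blast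
    qed
    moreover have MX: "M \<subseteq> X"
    proof
      fix m assume "m \<in> M"
      then have "m + 0 * a \<in> X" unfolding X_def using subringD(1)[OF A] by blast
      then show "m \<in> X" by simp
    qed
    moreover have "X \<inter> S = {}" using no unfolding X_def by auto
    ultimately have "X = M" using max IM unfolding C_def by blast
    moreover have "0 + 1 * a \<in> X"
      unfolding X_def using idealD(2)[OF idM] subringD(2)[OF A] by blast
    ultimately show False using a by simp
  qed
  have "prime_on A M"
    unfolding prime_on_def
  proof (intro conjI ballI impI)
    show "ideal_on A M" by fact
    show "1 \<notin> M" using MS S by auto
  next
    fix a b assume ab: "a \<in> A" "b \<in> A" "a * b \<in> M"
    show "a \<in> M \<or> b \<in> M"
    proof (rule ccontr)
      assume "\<not> ?thesis"
      then obtain m u m' u' where *: "m \<in> M" "u \<in> A" "m + u * a \<in> S"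
        "m' \<in> M" "u' \<in> A" "m' + u' * b \<in> S" using meets ab by meson
      \<comment> \<open>The left side is a product of two elements of \<open>S\<close>; every term
        on the right carries a factor from \<open>M\<close> or the factor
        \<open>a * b\<close>.\<close>
      have "(m + u * a) * (m' + u' * b) =
          (m' + u' * b) * m + ((u * a) * m' + (u * u') * (a * b))"
        by (simp add: algebra_simps)
      also have "\<dots> \<in> M"
        using * ab S(1) idealD(4)[OF idM, of "u * a" m'] idealD(4)[OF idM, of "u * u'" "a * b"]
          idealD(4)[OF idM, of "m' + u' * b" m] subringD(5)[OF A]
        by (intro idealD(3)[OF idM]) auto
      finally show False using S(3)[OF *(3,6)] MS by auto
    qed
  qed
  then show ?thesis using that IM MS by auto
qed

section \<open>Extending a generic point by one coordinate\<close>

abbreviation coeffs_in :: "'a::zero set \<Rightarrow> 'a poly \<Rightarrow> bool" where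
  "coeffs_in A F \<equiv> \<forall>k. coeff F k \<in> A"

lemma coeffs_in_ring_ops:
  assumes A: "is_subring A"
  shows "coeffs_in A F \<Longrightarrow> coeffs_in A G \<Longrightarrow> coeffs_in A (F + G)"
    "coeffs_in A F \<Longrightarrow> coeffs_in A G \<Longrightarrow> coeffs_in A (F - G)"
    "coeffs_in A F \<Longrightarrow> coeffs_in A G \<Longrightarrow> coeffs_in A (F * G)"
    "a \<in> A \<Longrightarrow> coeffs_in A F \<Longrightarrow> coeffs_in A (smult a F)"
    "a \<in> A \<Longrightarrow> coeffs_in A (monom a m)"
  using A by (auto simp: coeff_mult intro!: subringD subring_sum)

lemma poly_in_subring:
  assumes "is_subring A" "coeffs_in A F" "x \<in> A"
  shows "poly F x \<in> A"
  unfolding poly_altdef using assms by (auto intro!: subring_sum subringD subring_power)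

lemma poly_in_ideal:
  assumes "is_subring A" "ideal_on A I" "coeffs_in I F" "x \<in> A"
  shows "poly F x \<in> I"
  unfolding poly_altdef using assms by (auto intro!: ideal_sum idealD(5) subring_power)

lemma coeffs_in_ideal_mult:
  assumes "is_subring A" "ideal_on A I" "coeffs_in A F" "coeffs_in I G"
  shows "coeffs_in I (F * G)"
  using assms by (auto simp: coeff_mult intro!: ideal_sum idealD(4))

lemma pseudo_division_on:
  fixes A :: "'a::comm_ring_1 set"
  assumes A: "is_subring A" and G: "coeffs_in A G" "degree G > 0" and F: "coeffs_in A F"
  shows "\<exists>k Q R. smult (lead_coeff G ^ k) F = G * Q + R \<and> degree R < degree G \<and>
           degree Q \<le> degree F - degree G \<and> coeffs_in A Q \<and> coeffs_in A R"
  using F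
proof (induction "degree F" arbitrary: F rule: less_induct)
  case less
  show ?case
  proof (cases "degree F < degree G")
    case True
    then show ?thesis
      using less.prems subringD(1)[OF A]
      by (intro exI[of _ 0] exI[of _ 0] exI[of _ F]) auto
  next
    case False
    define b where "b = lead_coeff G"
    define a where "a = lead_coeff F"
    define m where "m = degree F - degree G"
    \<comment> \<open>Cross-multiplication cancels the top coefficients. Since zero divisors are
      possible, the drop in degree is read off from the coefficients.\<close>
    define F' where "F' = smult b F - monom a m * G"
    have ab: "a \<in> A" "b \<in> A" using less.prems G by (auto simp: a_def b_def)
    have cF': "coeffs_in A F'"
      unfolding F'_def using ab less.prems G by (intro coeffs_in_ring_ops[OF A]) auto
    have "degree (monom a m * G) \<le> m + degree G"
      by (metis add_le_mono1 degree_monom_le degree_mult_le le_trans)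
    then have le: "degree F' \<le> degree F"
      unfolding F'_def using False
      by (intro degree_diff_le) (auto simp: m_def intro: order.trans[OF degree_smult_le])
    have "coeff F' (degree F) = 0"
      unfolding F'_def using False by (simp add: coeff_monom_mult m_def a_def b_def)
    then have "\<forall>k\<ge>degree F. coeff F' k = 0"
      using le by (metis coeff_eq_0 le_eq_less_or_eq le_less_trans)
    then have lt: "degree F' < degree F" using False G by (intro degree_lessI) auto
    from less.hyps[OF lt cF'] obtain k Q R where
      *: "smult (b ^ k) F' = G * Q + R" "degree R < degree G"
        "degree Q \<le> degree F' - degree G" "coeffs_in A Q" "coeffs_in A R"
      unfolding b_def by blast
    define Q' where "Q' = Q + smult (b ^ k) (monom a m)"
    have "smult (b ^ Suc k) F = smult (b ^ k) F' + smult (b ^ k) (monom a m * G)"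
      unfolding F'_def by (simp add: smult_diff_right mult.commute)
    also have "\<dots> = G * Q' + R" unfolding * Q'_def by (simp add: algebra_simps)
    finally have eq: "smult (b ^ Suc k) F = G * Q' + R" .
    have "degree Q' \<le> degree F - degree G"
      unfolding Q'_def using *(3) lt
      by (intro degree_add_le)
        (auto simp: m_def intro: order.trans[OF degree_smult_le] degree_monom_le)
    moreover have "coeffs_in A Q'"
      unfolding Q'_def using * ab by (intro coeffs_in_ring_ops[OF A] subring_power[OF A]) auto
    ultimately show ?thesis using eq *(2,5) unfolding b_def by blast
  qed
qed

locale complex_hom =
  fixes e :: "'a::comm_ring_1 \<Rightarrow> complex"
  assumes e_add: "e (a + b) = e a + e b" and e_mult: "e (a * b) = e a * e b" and e_1: "e 1 = 1"
begin

lemma e_0: "e 0 = 0"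
  using e_add[of 0 0] by simp

lemma e_minus: "e (a - b) = e a - e b"
  using e_add[of "a - b" b] by simp

lemma e_power: "e (a ^ k) = e a ^ k"
  by (induction k) (auto simp: e_1 e_mult)

lemma e_sum: "e (sum f X) = (\<Sum>i\<in>X. e (f i))"
  by (induction X rule: infinite_finite_induct) (auto simp: e_0 e_add)

lemma map_poly_hom:
  "map_poly e (F + G) = map_poly e F + map_poly e G"
  "map_poly e (F - G) = map_poly e F - map_poly e G"
  "map_poly e (F * G) = map_poly e F * map_poly e G"
  "map_poly e (smult a F) = smult (e a) (map_poly e F)"
  by (auto intro!: poly_eqI simp: coeff_map_poly e_0 e_add e_minus e_mult coeff_mult e_sum)

lemma e_poly: "e (poly F x) = poly (map_poly e F) (e x)"
  by (induction F) (auto simp: map_poly_pCons e_0 e_add e_mult)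

text \<open>If \<open>x\<close> is transcendental over \<open>A\<close> modulo \<open>M\<close>, countability leaves room for a
  transcendental value; otherwise a polynomial of least degree in \<open>M\<close> plays the role of the
  minimal polynomial and any of its roots will do.\<close>

lemma extend_generic:
  fixes A B M :: "'a set"
  assumes A: "is_subring A" and B: "is_subring B" and AB: "A \<subseteq> B" and x: "x \<in> B"
    and M: "prime_on B M" and ker: "\<And>a. a \<in> A \<Longrightarrow> e a = 0 \<longleftrightarrow> a \<in> M"
    and cnt: "countable A"
  obtains c where "\<And>F. coeffs_in A F \<Longrightarrow> poly F x \<in> M \<longleftrightarrow> poly (map_poly e F) c = 0"
proof -
  have idM: "ideal_on B M" using primeD[OF M] by auto
  \<comment> \<open>Applying \<open>e\<close> to coefficients in \<open>A\<close> amounts to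
    reducing them modulo \<open>M\<close>.\<close>
  have Z: "map_poly e F = 0 \<longleftrightarrow> coeffs_in M F" if "coeffs_in A F" for F
    using that ker by (auto simp: poly_eq_iff coeff_map_poly e_0)
  have BF: "poly F x \<in> B" if "coeffs_in A F" for F
    using that AB x by (intro poly_in_subring[OF B]) auto
  have inM: "poly F x \<in> M" if "coeffs_in M F" for F
    using that x by (intro poly_in_ideal[OF B idM]) auto
  show ?thesis
  proof (cases "\<forall>F. coeffs_in A F \<and> poly F x \<in> M \<longrightarrow> map_poly e F = 0")
    case True
    \<comment> \<open>Transcendental case. The nonzero images of polynomials over \<open>A\<close>
      have only countably many roots altogether, and any \<open>c\<close> off these roots
      works.\<close>
    define FS where "FS = {F. coeffs_in A F \<and> map_poly e F \<noteq> 0}"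
    have "{F. coeffs_in A F} \<subseteq> Poly ` lists A"
    proof safe
      fix F :: "'a poly" assume "coeffs_in A F"
      then have "coeffs F \<in> lists A" by (auto simp: coeffs_def split: if_splits)
      then show "F \<in> Poly ` lists A" by (metis Poly_coeffs image_eqI)
    qed
    then have "countable {F. coeffs_in A F}"
      using cnt by (meson countable_image countable_lists countable_subset)
    then have "countable FS" unfolding FS_def by (rule countable_subset[rotated]) auto
    moreover have "countable {z. poly (map_poly e F) z = 0}" if "F \<in> FS" for F
      using that poly_roots_finite[of "map_poly e F"]
      by (auto simp: FS_def intro: countable_finite)
    ultimately have "countable (\<Union>F\<in>FS. {z. poly (map_poly e F) z = 0})" by blast
    then obtain c where c: "c \<notin> (\<Union>F\<in>FS. {z. poly (map_poly e F) z = 0})"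
      using uncountable_UNIV_complex by (metis UNIV_eq_I)
    have "poly F x \<in> M \<longleftrightarrow> poly (map_poly e F) c = 0" if F: "coeffs_in A F" for F
      using c F True Z[OF F] inM[of F] unfolding FS_def by auto
    then show ?thesis using that by blast
  next
    case False
    have tail: "\<exists>F'. coeffs_in A F' \<and> degree F' < degree F \<and> map_poly e F' = map_poly e F \<and>
        (poly F x \<in> M \<longrightarrow> poly F' x \<in> M)"
      if F: "coeffs_in A F" "map_poly e F \<noteq> 0" "lead_coeff F \<in> M" for F
    proof -
      define F' where "F' = F - monom (lead_coeff F) (degree F)"
      have eq: "map_poly e F' = map_poly e F"
        unfolding F'_def using F ker
        by (intro poly_eqI) (auto simp: coeff_map_poly e_0 e_minus)
      have "degree F > 0"
      proof (rule ccontr)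
        assume "\<not> ?thesis"
        then have "coeffs_in M F"
          using F(3) idealD(2)[OF idM] by (metis coeff_eq_0 gr0I)
        then show False using Z F by auto
      qed
      moreover have "\<forall>k\<ge>degree F. coeff F' k = 0"
        unfolding F'_def by (auto simp: coeff_eq_0)
      ultimately have "degree F' < degree F" by (intro degree_lessI) auto
      moreover have "coeffs_in A F'"
        unfolding F'_def using F by (intro coeffs_in_ring_ops[OF A]) auto
      moreover have "poly F' x \<in> M" if "poly F x \<in> M"
        unfolding F'_def using that F(3) x
        by (auto simp: poly_monom intro!: ideal_diff[OF B idM] idealD(5)[OF idM] subring_power[OF B])
      ultimately show ?thesis using eq by blast
    qed
    define N where "N = (\<lambda>F. coeffs_in A F \<and> poly F x \<in> M \<and> map_poly e F \<noteq> 0)"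
    obtain F where F: "N F" and minF: "\<And>G. N G \<Longrightarrow> degree F \<le> degree G"
      using False ex_has_least_nat[of N _ degree] unfolding N_def by blast
    define d where "d = degree F"
    define a where "a = lead_coeff F"
    have cF: "coeffs_in A F" and xF: "poly F x \<in> M" and nF: "map_poly e F \<noteq> 0"
      using F unfolding N_def by auto
    have aA: "a \<in> A" using cF a_def by auto
    have aM: "a \<notin> M"
      using tail[OF cF nF] xF minF nF unfolding N_def a_def by (metis not_less)
    have small: "coeffs_in M G" if "coeffs_in A G" "poly G x \<in> M" "degree G < d" for G
      using minF[of G] that Z unfolding N_def d_def by force
    have d0: "d > 0"
    proof (rule ccontr)
      assume "\<not> ?thesis"
      then have "F = [:a:]" by (metis a_def d_def degree_eq_zeroE gr0I coeff_pCons_0)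
      then show False using xF aM by auto
    qed
    \<comment> \<open>The leading coefficient survives \<open>e\<close>, so the image still has
      positive degree and hence a complex root.\<close>
    have degF: "degree (map_poly e F) = d"
    proof (rule antisym)
      show "degree (map_poly e F) \<le> d" 
        unfolding d_def by (intro degree_le) (auto simp: coeff_map_poly e_0 coeff_eq_0)
      show "d \<le> degree (map_poly e F)"
        using ker[OF aA] aM by (intro le_degree) (auto simp: coeff_map_poly e_0 a_def d_def)
    qed
    then obtain c where c: "poly (map_poly e F) c = 0"
      using fundamental_theorem_of_algebra[of "map_poly e F"] d0
        constant_degree[of "map_poly e F"] by auto
    have val: "e b ^ k * poly (map_poly e H) c =
        poly (map_poly e G) c * poly (map_poly e Q) c + poly (map_poly e R) c"
      if "smult (b ^ k) H = G * Q + R" for b k H G Q R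
      using arg_cong[OF that, of "\<lambda>p. poly (map_poly e p) c"]
      by (simp add: map_poly_hom e_power)
    \<comment> \<open>The image of \<open>F\<close> also has least degree among nonzero images
      vanishing at \<open>c\<close>. Otherwise pseudo-divide \<open>F\<close> by a least-degree
      \<open>G0\<close> of degree below \<open>d\<close>: the remainder is trivial modulo
      \<open>M\<close>, so primality puts \<open>poly G0 x\<close> or \<open>poly Q x\<close> in
      \<open>M\<close>.\<close>
    have van_deg: "d \<le> degree G"
      if G: "coeffs_in A G" "poly (map_poly e G) c = 0" "map_poly e G \<noteq> 0" for G
    proof (rule ccontr)
      define N' where "N' = (\<lambda>G. coeffs_in A G \<and> poly (map_poly e G) c = 0 \<and> map_poly e G \<noteq> 0)"
      assume dG: "\<not> d \<le> degree G"
      have NG: "N' G" using G unfolding N'_def by blast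
      then obtain G0 where G0: "N' G0" and min0: "\<And>G. N' G \<Longrightarrow> degree G0 \<le> degree G"
        using ex_has_least_nat[of N' G degree] by blast
      then have lt: "degree G0 < d"
        using min0[OF NG] dG by linarith
      have cG: "coeffs_in A G0" and vG: "poly (map_poly e G0) c = 0" and nG: "map_poly e G0 \<noteq> 0"
        using G0 unfolding N'_def by auto
      define b where "b = lead_coeff G0"
      have bA: "b \<in> A" using cG b_def by auto
      have bM: "b \<notin> M"
        using tail[OF cG nG] vG nG min0 unfolding N'_def b_def by (metis not_less)
      have dG0: "degree G0 > 0"
      proof (rule ccontr)
        assume "\<not> ?thesis"
        then obtain g where "G0 = [:g:]" by (metis degree_eq_zeroE gr0I)
        then show False using vG nG by (auto simp: map_poly_pCons e_0)
      qed
      from pseudo_division_on[OF A cG dG0 cF] obtain k Q R where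
        *: "smult (b ^ k) F = G0 * Q + R" "degree R < degree G0"
          "degree Q \<le> degree F - degree G0" "coeffs_in A Q" "coeffs_in A R"
        unfolding b_def by blast
      have "poly (map_poly e R) c = 0" using val[OF *(1)] c vG by simp
      then have "map_poly e R = 0" using min0[of R] * unfolding N'_def by force
      then have RM: "coeffs_in M R" using Z[OF *(5)] by simp
      have "poly G0 x * poly Q x = b ^ k * poly F x - poly R x"
        using arg_cong[OF *(1), of "\<lambda>p. poly p x"] by simp
      also have "\<dots> \<in> M"
        using bA AB xF inM[OF RM]
        by (intro ideal_diff[OF B idM] idealD(4)[OF idM] subring_power[OF B]) auto
      finally have "poly G0 x \<in> M \<or> poly Q x \<in> M"
        using primeD(3)[OF M] BF cG *(4) by blast
      then show False
      proof
        assume "poly G0 x \<in> M"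
        then show False using minF[of G0] cG nG lt unfolding N_def d_def by auto
      next
        assume "poly Q x \<in> M"
        moreover have "degree Q < d" using *(3) dG0 d0 unfolding d_def by linarith
        ultimately have "coeffs_in M Q" using small *(4) by blast
        then have "coeffs_in M (G0 * Q)"
          using cG AB by (intro coeffs_in_ideal_mult[OF B idM]) auto
        \<comment> \<open>In degree \<open>d\<close> the other side of the pseudo-division has
          coefficient \<open>b ^ k * a\<close>, where neither \<open>a\<close> nor \<open>b\<close>
          lies in the prime \<open>M\<close>.\<close>
        then have "coeff (G0 * Q + R) d \<in> M" using RM idealD(3)[OF idM] by auto
        then have "b ^ k * a \<in> M" using *(1) by (metis a_def coeff_smult d_def)
        then have "b ^ k \<in> M"
          using primeD(3)[OF M, of "b ^ k" a] aM bA aA AB subring_power[OF A bA, of k] by blast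
        then show False using prime_power[OF B M] bA AB bM by blast
      qed
    qed
    \<comment> \<open>Pseudo-division by \<open>F\<close> reduces both sides to the remainder
      \<open>R\<close>. Below degree \<open>d\<close>, membership at \<open>x\<close> and vanishing
      at \<open>c\<close> each mean that \<open>R\<close> is trivial modulo
      \<open>M\<close>.\<close>
    have "poly G x \<in> M \<longleftrightarrow> poly (map_poly e G) c = 0" if cG: "coeffs_in A G" for G
    proof -
      from pseudo_division_on[OF A cF _ cG] d0 obtain k Q R where
        *: "smult (a ^ k) G = F * Q + R" "degree R < d" "coeffs_in A Q" "coeffs_in A R"
        unfolding a_def d_def by blast
      have ea: "e a ^ k \<noteq> 0" using ker[OF aA] aM by auto
      have akA: "a ^ k \<in> A" using subring_power[OF A aA] .
      have xeq: "a ^ k * poly G x = poly F x * poly Q x + poly R x"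
        using arg_cong[OF *(1), of "\<lambda>p. poly p x"] by simp
      have FQ: "poly F x * poly Q x \<in> M" using xF BF[OF *(3)] idealD(5)[OF idM] by blast
      have "poly G x \<in> M \<longleftrightarrow> a ^ k * poly G x \<in> M"
        using akA AB idealD(4)[OF idM] primeD(3)[OF M _ BF[OF cG], of "a ^ k"]
          prime_power[OF B M, of a k] aA aM by blast
      also have "\<dots> \<longleftrightarrow> poly R x \<in> M"
        using FQ ideal_diff[OF B idM, of "a ^ k * poly G x" "poly F x * poly Q x"]
          idealD(3)[OF idM FQ, of "poly R x"] unfolding xeq by auto
      also have "\<dots> \<longleftrightarrow> map_poly e R = 0"
        using small[OF *(4) _ *(2)] inM Z[OF *(4)] by blast
      also have "\<dots> \<longleftrightarrow> poly (map_poly e R) c = 0"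
        using van_deg[OF *(4)] *(2) by auto
      also have "\<dots> \<longleftrightarrow> poly (map_poly e G) c = 0"
        using val[OF *(1)] c ea by auto
      finally show ?thesis .
    qed
    then show ?thesis using that by blast
  qed
qed

end

section \<open>Evaluation of polynomials\<close>

definition monom_val :: "(nat \<Rightarrow> complex) \<Rightarrow> (nat \<Rightarrow>\<^sub>0 nat) \<Rightarrow> complex" where
  "monom_val \<xi> m = (\<Prod>j\<in>Poly_Mapping.keys m. \<xi> j ^ Poly_Mapping.lookup m j)"

text \<open>The evaluation of \<open>meval\<close>, but at an assignment of all indices, so that a
  point can be changed or extended at a single index, such as the auxiliary index
  \<open>n\<close>.\<close>

definition ev :: "(nat \<Rightarrow> complex) \<Rightarrow> mpoly \<Rightarrow> complex" where
  "ev \<xi> p = (\<Sum>m\<in>Poly_Mapping.keys p. of_rat (Poly_Mapping.lookup p m) * monom_val \<xi> m)"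

lemma meval_eq_ev: "meval p xs = ev ((!) xs) p"
  unfolding meval_def ev_def monom_val_def by simp

lemma poly_mapping_sum_single:
  "(\<Sum>k\<in>Poly_Mapping.keys p. Poly_Mapping.single k (Poly_Mapping.lookup p k)) = p"
proof (rule poly_mapping_eqI)
  fix k
  have "Poly_Mapping.lookup
      (\<Sum>l\<in>Poly_Mapping.keys p. Poly_Mapping.single l (Poly_Mapping.lookup p l)) k =
      (\<Sum>l\<in>Poly_Mapping.keys p. if l = k then Poly_Mapping.lookup p k else 0)"
    unfolding lookup_sum by (intro sum.cong) (auto simp: lookup_single when_def)
  also have "\<dots> = Poly_Mapping.lookup p k"
    by (auto simp: in_keys_iff)
  finally show "Poly_Mapping.lookup
      (\<Sum>l\<in>Poly_Mapping.keys p. Poly_Mapping.single l (Poly_Mapping.lookup p l)) k =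
      Poly_Mapping.lookup p k" .
qed

lemma monom_val_superset:
  assumes "finite K" "Poly_Mapping.keys m \<subseteq> K"
  shows "monom_val \<xi> m = (\<Prod>j\<in>K. \<xi> j ^ Poly_Mapping.lookup m j)"
  unfolding monom_val_def using assms by (intro prod.mono_neutral_left) (auto simp: in_keys_iff)

lemma monom_val_add: "monom_val \<xi> (m + m') = monom_val \<xi> m * monom_val \<xi> m'"
proof -
  let ?K = "Poly_Mapping.keys m \<union> Poly_Mapping.keys m'"
  have "monom_val \<xi> (m + m') = (\<Prod>j\<in>?K. \<xi> j ^ Poly_Mapping.lookup (m + m') j)"
    using keys_add[of m m'] by (intro monom_val_superset) auto
  also have "\<dots> = monom_val \<xi> m * monom_val \<xi> m'"
    by (simp add: monom_val_superset[of ?K] lookup_add power_add prod.distrib)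
  finally show ?thesis .
qed

lemma monom_val_0 [simp]: "monom_val \<xi> 0 = 1"
  unfolding monom_val_def by simp

lemma monom_val_single [simp]: "monom_val \<xi> (Poly_Mapping.single v k) = \<xi> v ^ k"
  unfolding monom_val_def by (cases "k = 0") auto

lemma ev_add: "ev \<xi> (p + q) = ev \<xi> p + ev \<xi> q"
  unfolding ev_def
  by (rule setsum_keys_plus_distrib) (auto simp: of_rat_add algebra_simps)

lemma ev_0 [simp]: "ev \<xi> 0 = 0"
  unfolding ev_def by simp

lemma ev_sum: "ev \<xi> (sum f X) = (\<Sum>i\<in>X. ev \<xi> (f i))"
  by (induction X rule: infinite_finite_induct) (auto simp: ev_add)

lemma ev_single: "ev \<xi> (Poly_Mapping.single m a) = of_rat a * monom_val \<xi> m"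
  unfolding ev_def by (cases "a = 0") auto

lemma ev_mult: "ev \<xi> (p * q) = ev \<xi> p * ev \<xi> q"
proof -
  have "p * q = (\<Sum>m\<in>Poly_Mapping.keys p. \<Sum>l\<in>Poly_Mapping.keys q.
      Poly_Mapping.single (m + l) (Poly_Mapping.lookup p m * Poly_Mapping.lookup q l))"
    using arg_cong2[OF poly_mapping_sum_single[of p, symmetric]
        poly_mapping_sum_single[of q, symmetric], of "(*)"]
    by (simp add: sum_product mult_single)
  then have "ev \<xi> (p * q) = (\<Sum>m\<in>Poly_Mapping.keys p. \<Sum>l\<in>Poly_Mapping.keys q.
      (of_rat (Poly_Mapping.lookup p m) * monom_val \<xi> m) *
      (of_rat (Poly_Mapping.lookup q l) * monom_val \<xi> l))"
    by (simp add: ev_sum ev_single monom_val_add of_rat_mult mult_ac)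
  then show ?thesis unfolding ev_def by (simp add: sum_product)
qed

lemma ev_1: "ev \<xi> 1 = 1"
  using ev_single[of \<xi> 0 1] by simp

interpretation ev: complex_hom "ev \<xi>" for \<xi>
  by unfold_locales (auto simp: ev_add ev_mult ev_1)

lemma ev_mconst [simp]: "ev \<xi> (mconst a) = of_rat a"
  unfolding mconst_def ev_single by simp

lemma ev_mvar [simp]: "ev \<xi> (mvar v) = \<xi> v"
  unfolding mvar_def ev_single by simp

lemma ev_cong:
  assumes "mvars p \<subseteq> V" "\<And>v. v \<in> V \<Longrightarrow> \<xi> v = \<xi>' v"
  shows "ev \<xi> p = ev \<xi>' p"
  unfolding ev_def monom_val_def
  using assms unfolding mvars_def by (intro sum.cong prod.cong arg_cong2[of _ _ _ _ "(*)"]) auto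

section \<open>Polynomials in given variables\<close>

definition poly_ring :: "nat set \<Rightarrow> mpoly set" where
  "poly_ring V = {p. mvars p \<subseteq> V}"

lemma poly_ring_mono: "V \<subseteq> W \<Longrightarrow> poly_ring V \<subseteq> poly_ring W"
  unfolding poly_ring_def by auto

lemma mconst_in_poly_ring: "mconst a \<in> poly_ring V"
  unfolding poly_ring_def mvars_def mconst_def by auto

lemma mvar_in_poly_ring: "v \<in> V \<Longrightarrow> mvar v \<in> poly_ring V"
  unfolding poly_ring_def mvars_def mvar_def by auto

lemma subring_poly_ring: "is_subring (poly_ring V)"
proof -
  have add: "mvars (p + q) \<subseteq> mvars p \<union> mvars q" for p q
    using keys_add[of p q] unfolding mvars_def by blast
  have mult: "mvars (p * q) \<subseteq> mvars p \<union> mvars q" for p q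
  proof
    fix v assume "v \<in> mvars (p * q)"
    then obtain m where m: "m \<in> Poly_Mapping.keys (p * q)" "v \<in> Poly_Mapping.keys m"
      unfolding mvars_def by auto
    then obtain a b where "m = a + b" "a \<in> Poly_Mapping.keys p" "b \<in> Poly_Mapping.keys q"
      using keys_mult[of p q] by auto
    then show "v \<in> mvars p \<union> mvars q" using m keys_add[of a b] unfolding mvars_def by auto
  qed
  have neg: "mvars (- p) = mvars p" for p
    unfolding mvars_def by (simp add: in_keys_iff Poly_Mapping.keys.rep_eq)
  have "mvars 0 = {}" "mvars 1 = {}"
    unfolding mvars_def by auto
  moreover have "mvars (a + b) \<subseteq> V" "mvars (a * b) \<subseteq> V" if "mvars a \<subseteq> V" "mvars b \<subseteq> V" for a b
    using that add[of a b] mult[of a b] by blast+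
  ultimately show ?thesis
    unfolding is_subring_def poly_ring_def using neg by simp
qed

text \<open>Powers of a variable are assembled first, then monomials variable by variable, then
  finite sums of terms.\<close>

lemma poly_ring_induct [consumes 1, case_names const var add mult]:
  assumes "p \<in> poly_ring V"
    and "\<And>a. Q (mconst a)" "\<And>v. v \<in> V \<Longrightarrow> Q (mvar v)"
    and "\<And>p q. Q p \<Longrightarrow> Q q \<Longrightarrow> Q (p + q)" "\<And>p q. Q p \<Longrightarrow> Q q \<Longrightarrow> Q (p * q)"
  shows "Q p"
proof -
  have Q0: "Q 0" and Q1: "Q 1"
    using assms(2)[of 0] assms(2)[of 1] unfolding mconst_def by simp_all
  have mon: "Q (Poly_Mapping.single m 1)" if "Poly_Mapping.keys m \<subseteq> V" for m
  proof -
    have pow: "Q (Poly_Mapping.single (Poly_Mapping.single v k) 1)" if "v \<in> V" for v k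
    proof (induction k)
      case 0
      then show ?case using Q1 by simp
    next
      case (Suc k)
      have "Poly_Mapping.single (Poly_Mapping.single v (Suc k)) (1::rat) =
          mvar v * Poly_Mapping.single (Poly_Mapping.single v k) 1"
        unfolding mvar_def by (simp add: mult_single flip: single_add)
      then show ?case using Suc assms(3,5) that by simp
    qed
    have "Q (Poly_Mapping.single (\<Sum>j\<in>X. Poly_Mapping.single j (Poly_Mapping.lookup m j)) 1)"
      if "finite X" "X \<subseteq> V" for X
      using that
    proof (induction X)
      case empty
      then show ?case using Q1 by simp
    next
      case (insert j X)
      have "Poly_Mapping.single
          (\<Sum>j\<in>insert j X. Poly_Mapping.single j (Poly_Mapping.lookup m j)) (1::rat) =
          Poly_Mapping.single (Poly_Mapping.single j (Poly_Mapping.lookup m j)) 1 *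
          Poly_Mapping.single (\<Sum>j\<in>X. Poly_Mapping.single j (Poly_Mapping.lookup m j)) 1"
        using insert by (simp add: mult_single)
      then show ?case using insert pow assms(5) by simp
    qed
    from this[of "Poly_Mapping.keys m"] show ?thesis
      using that by (simp add: poly_mapping_sum_single)
  qed
  have "Q (\<Sum>m\<in>X. Poly_Mapping.single m (Poly_Mapping.lookup p m))"
    if "finite X" "X \<subseteq> Poly_Mapping.keys p" for X
    using that
  proof (induction X)
    case empty
    then show ?case using Q0 by simp
  next
    case (insert m X)
    have "Poly_Mapping.single m (Poly_Mapping.lookup p m) =
        mconst (Poly_Mapping.lookup p m) * Poly_Mapping.single m 1"
      unfolding mconst_def by (simp add: mult_single)
    moreover have "Poly_Mapping.keys m \<subseteq> V"
      using assms(1) insert.prems unfolding poly_ring_def mvars_def by auto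
    ultimately have "Q (Poly_Mapping.single m (Poly_Mapping.lookup p m))"
      using mon assms(2,5) by simp
    then show ?case using insert assms(4) by simp
  qed
  from this[of "Poly_Mapping.keys p"] show ?thesis by (simp add: poly_mapping_sum_single)
qed

text \<open>A finitely supported map is determined by its graph over its support, and a countable
  set has only countably many finite subsets.\<close>

lemma countable_poly_mapping:
  assumes "countable (UNIV :: 'a set)" "countable (UNIV :: 'b::zero set)"
  shows "countable (UNIV :: ('a \<Rightarrow>\<^sub>0 'b) set)"
proof -
  define g :: "('a \<Rightarrow>\<^sub>0 'b) \<Rightarrow> ('a \<times> 'b) set"
    where "g = (\<lambda>p. (\<lambda>k. (k, Poly_Mapping.lookup p k)) ` Poly_Mapping.keys p)"
  have "inj g"
  proof (rule injI, rule poly_mapping_eqI)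
    fix p q k assume eq: "g p = g q"
    have "b = Poly_Mapping.lookup p k \<and> b \<noteq> 0 \<longleftrightarrow> (k, b) \<in> g p" for p b
      unfolding g_def by (auto simp: in_keys_iff)
    then show "Poly_Mapping.lookup p k = Poly_Mapping.lookup q k" using eq by metis
  qed
  moreover have "range g \<subseteq> {X. finite X \<and> X \<subseteq> UNIV \<times> UNIV}" unfolding g_def by auto
  then have "countable (range g)"
    using countable_Collect_finite_subset[of "UNIV \<times> UNIV :: ('a \<times> 'b) set"]
      countable_SIGMA[OF assms(1), of "\<lambda>_. UNIV :: 'b set"] assms(2)
    by (meson countable_subset)
  ultimately show ?thesis by (metis countable_image_inj_on)
qed

lemma countable_poly_ring: "countable (poly_ring V)"
proof -
  have "countable (UNIV :: mpoly set)"
    by (intro countable_poly_mapping) auto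
  then show ?thesis by (rule countable_subset[OF subset_UNIV])
qed

text \<open>Brings a polynomial in one more variable into the univariate form that
  \<open>extend_generic\<close> handles.\<close>

lemma poly_ring_insert_univariate:
  assumes "p \<in> poly_ring (insert v V)"
  obtains F where "coeffs_in (poly_ring V) F" "p = poly F (mvar v)"
proof -
  note R = coeffs_in_ring_ops[OF subring_poly_ring[of V]] subringD(1,2)[OF subring_poly_ring[of V]]
  have pCons: "coeffs_in (poly_ring V) (pCons a F)"
    if "a \<in> poly_ring V" "coeffs_in (poly_ring V) F" for a F
    using that by (auto simp: coeff_pCons split: nat.splits)
  have "\<exists>F. coeffs_in (poly_ring V) F \<and> p = poly F (mvar v)"
    using assms
  proof (induction p rule: poly_ring_induct)
    case (const a)
    show ?case
      using pCons[OF mconst_in_poly_ring[of a], of 0] R by (intro exI[of _ "[:mconst a:]"]) auto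
  next
    case (var w)
    show ?case
    proof (cases "w = v")
      case True
      then show ?thesis
        using pCons[of 0 "[:1:]"] pCons[of 1 0] R by (intro exI[of _ "[:0, 1:]"]) auto
    next
      case False
      then show ?thesis
        using pCons[OF mvar_in_poly_ring[of w], of 0] var R
        by (intro exI[of _ "[:mvar w:]"]) auto
    qed
  next
    case (add p q)
    then show ?case by (metis R(1) poly_add)
  next
    case (mult p q)
    then show ?case by (metis R(3) poly_mult)
  qed
  then show ?thesis using that by blast
qed

text \<open>The remaining coordinates are chosen one after another with
  \<open>extend_generic\<close>, keeping the vanishing ideal equal to the part of \<open>M\<close>
  in the variables treated so far.\<close>

lemma generic_point_extend:
  assumes W: "finite W" "V \<subseteq> W" and M: "prime_on (poly_ring W) M"
    and ker: "\<And>f. f \<in> poly_ring V \<Longrightarrow> ev \<xi> f = 0 \<longleftrightarrow> f \<in> M"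
  obtains \<xi>' where "\<And>v. v \<in> V \<Longrightarrow> \<xi>' v = \<xi> v"
    "\<And>f. f \<in> poly_ring W \<Longrightarrow> ev \<xi>' f = 0 \<longleftrightarrow> f \<in> M"
proof -
  have "\<exists>\<xi>'. (\<forall>v\<in>V. \<xi>' v = \<xi> v) \<and> (\<forall>f\<in>poly_ring (V \<union> D). ev \<xi>' f = 0 \<longleftrightarrow> f \<in> M)"
    if "finite D" "D \<subseteq> W" for D
    using that
  proof (induction D)
    case empty
    then show ?case using ker by auto
  next
    case (insert v D)
    then obtain \<xi>' where \<xi>': "\<And>v. v \<in> V \<Longrightarrow> \<xi>' v = \<xi> v"
      "\<And>f. f \<in> poly_ring (V \<union> D) \<Longrightarrow> ev \<xi>' f = 0 \<longleftrightarrow> f \<in> M" by auto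
    show ?case
    proof (cases "v \<in> V")
      case True
      then show ?thesis using \<xi>' by (metis Un_insert_right insert_absorb Un_iff)
    next
      case False
      have "poly_ring (V \<union> D) \<subseteq> poly_ring W" "mvar v \<in> poly_ring W"
        using insert.prems W by (auto intro!: poly_ring_mono mvar_in_poly_ring)
      then obtain c where c: "\<And>F. coeffs_in (poly_ring (V \<union> D)) F \<Longrightarrow>
          poly F (mvar v) \<in> M \<longleftrightarrow> poly (map_poly (ev \<xi>') F) c = 0"
        using ev.extend_generic[OF subring_poly_ring subring_poly_ring _ _ M \<xi>'(2)
            countable_poly_ring] by metis
      \<comment> \<open>Since \<open>v\<close> is new or gets its first value here, the coefficients
        of \<open>F\<close> keep their values, and evaluation becomes substitution of
        \<open>c\<close> into the image of \<open>F\<close>.\<close>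
      define \<zeta> where "\<zeta> = \<xi>'(v := c)"
      have "ev \<zeta> f = 0 \<longleftrightarrow> f \<in> M" if f: "f \<in> poly_ring (V \<union> insert v D)" for f
      proof -
        obtain F where F: "coeffs_in (poly_ring (V \<union> D)) F" "f = poly F (mvar v)"
          using poly_ring_insert_univariate[of f v "V \<union> D"] f by auto
        have "map_poly (ev \<zeta>) F = map_poly (ev \<xi>') F"
        proof (rule poly_eqI)
          fix k
          have "ev \<zeta> (coeff F k) = ev \<xi>' (coeff F k)"
            using F(1) insert.hyps(2) False unfolding poly_ring_def \<zeta>_def
            by (intro ev_cong[of _ "V \<union> D"]) auto
          then show "coeff (map_poly (ev \<zeta>) F) k = coeff (map_poly (ev \<xi>') F) k"
            by (simp add: coeff_map_poly)
        qed
        then have "ev \<zeta> f = poly (map_poly (ev \<xi>') F) c"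
          unfolding F(2) ev.e_poly by (simp add: \<zeta>_def)
        then show ?thesis using c[OF F(1)] F(2) by simp
      qed
      moreover have "\<zeta> w = \<xi> w" if "w \<in> V" for w
        using \<xi>'(1) that False unfolding \<zeta>_def by auto
      ultimately show ?thesis by blast
    qed
  qed
  from this[of W] show ?thesis using that W by (metis Un_absorb1 order_refl)
qed

section \<open>Elimination ideals in one variable\<close>

definition rpoly :: "rat poly \<Rightarrow> complex \<Rightarrow> complex" where
  "rpoly q z = poly (map_poly of_rat q) z"

text \<open>Gives polynomials of different degrees a common range of summation.\<close>

lemma univ_embed_bound:
  assumes "degree q \<le> N"
  shows "univ_embed v q = (\<Sum>k\<le>N. Poly_Mapping.single (Poly_Mapping.single v k) (coeff q k))"
  unfolding univ_embed_def using assms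
  by (intro sum.mono_neutral_left) (auto simp: coeff_eq_0)

lemma univ_embed_0 [simp]: "univ_embed v 0 = 0"
  unfolding univ_embed_def by simp

lemma univ_embed_add: "univ_embed v (p + q) = univ_embed v p + univ_embed v q"
proof -
  let ?N = "max (degree p) (degree q)"
  have "degree (p + q) \<le> ?N" by (rule degree_add_le_max)
  then show ?thesis
    by (simp add: univ_embed_bound[of _ ?N] single_add sum.distrib)
qed

lemma univ_embed_smult: "univ_embed v (smult a q) = mconst a * univ_embed v q"
  by (simp add: univ_embed_bound[of _ "degree q"] degree_smult_le mconst_def mult_single
      sum_distrib_left)

lemma univ_embed_pCons: "univ_embed v (pCons a q) = mconst a + mvar v * univ_embed v q"
proof -
  have "univ_embed v (pCons a q) =
      (\<Sum>k\<le>Suc (degree q). Poly_Mapping.single (Poly_Mapping.single v k) (coeff (pCons a q) k))"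
    by (rule univ_embed_bound) (simp add: degree_pCons_le)
  also have "\<dots> = mconst a + (\<Sum>k\<le>degree q.
      Poly_Mapping.single (Poly_Mapping.single v (Suc k)) (coeff q k))"
    unfolding sum.atMost_Suc_shift by (simp add: mconst_def)
  also have "(\<Sum>k\<le>degree q. Poly_Mapping.single (Poly_Mapping.single v (Suc k)) (coeff q k)) =
      mvar v * univ_embed v q"
    unfolding mvar_def univ_embed_def
    by (simp add: sum_distrib_left mult_single flip: single_add)
  finally show ?thesis .
qed

lemma univ_embed_mult: "univ_embed v (p * q) = univ_embed v p * univ_embed v q"
proof (induction p)
  case (pCons a p)
  then show ?case
    by (simp add: univ_embed_add univ_embed_smult univ_embed_pCons algebra_simps)
      (simp add: mconst_def)
qed simp

lemma univ_embed_in_poly_ring: "v \<in> V \<Longrightarrow> univ_embed v q \<in> poly_ring V"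
  by (induction q)
    (auto simp: univ_embed_pCons
      intro!: subringD[OF subring_poly_ring] mconst_in_poly_ring mvar_in_poly_ring)

lemma poly_ring_singleton:
  assumes "p \<in> poly_ring {v}"
  obtains q where "p = univ_embed v q"
proof -
  have "p \<in> range (univ_embed v)"
    using assms
  proof (induction p rule: poly_ring_induct)
    case (const a)
    have "mconst a = univ_embed v [:a:]" by (simp add: univ_embed_pCons)
    then show ?case by blast
  next
    case (var w)
    then have "mvar w = univ_embed v [:0, 1:]" by (simp add: univ_embed_pCons mconst_def)
    then show ?case by blast
  next
    case (add p q)
    then show ?case by (auto simp flip: univ_embed_add)
  next
    case (mult p q)
    then show ?case by (auto simp flip: univ_embed_mult)
  qed
  then show ?thesis using that by auto
qed

lemma ev_univ_embed: "ev \<xi> (univ_embed v q) = rpoly q (\<xi> v)"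
  unfolding rpoly_def
  by (induction q) (auto simp: univ_embed_pCons ev_add ev_mult map_poly_pCons)

lemma rpoly_0 [simp]: "rpoly 0 z = 0"
  unfolding rpoly_def by simp

lemma rpoly_mult: "rpoly (p * q) z = rpoly p z * rpoly q z"
  using ev_univ_embed[of "\<lambda>_. z" 0] by (metis univ_embed_mult ev_mult)

lemma rpoly_add: "rpoly (p + q) z = rpoly p z + rpoly q z"
  using ev_univ_embed[of "\<lambda>_. z" 0] by (metis univ_embed_add ev_add)

lemma rpoly_1 [simp]: "rpoly 1 z = 1"
  unfolding rpoly_def by simp

lemma finite_rpoly_roots: "q \<noteq> 0 \<Longrightarrow> finite {z. rpoly q z = 0}"
  unfolding rpoly_def by (intro poly_roots_finite) (auto simp: poly_eq_iff coeff_map_poly)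

text \<open>A prime above \<open>J\<close> is found whose part in the variable \<open>v\<close> is
  the vanishing ideal of \<open>\<beta>\<close>; a generic point of it with
  \<open>v\<close>-coordinate \<open>\<beta>\<close> is the required zero. The hypothesis
  \<open>alg\<close> excludes cases such as the ideal of vw - 1 at \<beta> = 0, where
  \<open>van\<close> holds but no zero exists.\<close>

lemma zero_above_root:
  assumes W: "finite W" "v \<in> W" and J: "ideal_on (poly_ring W) J"
    and van: "\<And>q. univ_embed v q \<in> J \<Longrightarrow> rpoly q \<beta> = 0"
    and alg: "(\<exists>q. q \<noteq> 0 \<and> univ_embed v q \<in> J) \<or> (\<forall>q. rpoly q \<beta> = 0 \<longrightarrow> q = 0)"
  obtains \<xi> where "\<xi> v = \<beta>" "\<And>f. f \<in> J \<Longrightarrow> ev \<xi> f = 0"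
proof -
  \<comment> \<open>Avoiding \<open>S\<close> forces every polynomial in \<open>v\<close> alone that
    lies in the prime to vanish at \<open>\<beta>\<close>.\<close>
  define S where "S = univ_embed v ` {q. rpoly q \<beta> \<noteq> 0}"
  have one: "1 = univ_embed v 1"
    by (simp add: one_pCons univ_embed_pCons mconst_def del: pCons_one)
  obtain M where M: "prime_on (poly_ring W) M" and JM: "J \<subseteq> M" and MS: "M \<inter> S = {}"
  proof (rule prime_ideal_disjoint[OF subring_poly_ring J])
    show "S \<subseteq> poly_ring W" unfolding S_def using W univ_embed_in_poly_ring by auto
    show "1 \<in> S" unfolding S_def one by (intro imageI) simp
    show "J \<inter> S = {}" unfolding S_def using van by auto
    show "a * b \<in> S" if "a \<in> S" "b \<in> S" for a b
      using that unfolding S_def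
      by (auto simp: rpoly_mult simp flip: univ_embed_mult)
  qed
  have idM: "ideal_on (poly_ring W) M" using primeD(1)[OF M] .
  have Mvan: "rpoly q \<beta> = 0" if "univ_embed v q \<in> M" for q
    using that MS unfolding S_def by auto
  \<comment> \<open>This inclusion is trivial when \<open>\<beta>\<close> is transcendental;
    otherwise it suffices that the minimal polynomial \<open>p\<close> of \<open>\<beta>\<close>
    lies in \<open>M\<close>.\<close>
  have vanM: "univ_embed v q \<in> M" if q: "rpoly q \<beta> = 0" for q
  proof (cases "\<forall>q. rpoly q \<beta> = 0 \<longrightarrow> q = 0")
    case True
    then show ?thesis using q idealD(2)[OF idM] by auto
  next
    case False
    define N where "N = (\<lambda>p. p \<noteq> 0 \<and> rpoly p \<beta> = 0)"
    obtain p where p: "N p" and min: "\<And>q. N q \<Longrightarrow> degree p \<le> degree q"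
      using False ex_has_least_nat[of N _ degree] unfolding N_def by blast
    have dvd: "p dvd q" if "rpoly q \<beta> = 0" for q
    proof -
      have "rpoly q \<beta> = rpoly (q div p) \<beta> * rpoly p \<beta> + rpoly (q mod p) \<beta>"
        by (simp flip: rpoly_mult rpoly_add)
      then have "rpoly (q mod p) \<beta> = 0" using that p unfolding N_def by simp
      then have "q mod p = 0"
        using min[of "q mod p"] p degree_mod_less'[of p q] unfolding N_def by fastforce
      then show ?thesis by auto
    qed
    obtain g where "g \<noteq> 0" "univ_embed v g \<in> M" using alg False JM by blast
    \<comment> \<open>Primality peels factors \<open>p\<close> off \<open>g\<close>: either
      \<open>p\<close> is in \<open>M\<close>, or the cofactor, nonzero and of smaller degree, takes
      the role of \<open>g\<close>.\<close>
    then have "univ_embed v p \<in> M"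
    proof (induction "degree g" arbitrary: g rule: less_induct)
      case less
      obtain u where u: "g = p * u" using dvd[OF Mvan[OF less.prems(2)]] by (elim dvdE)
      have "univ_embed v p \<in> M \<or> univ_embed v u \<in> M"
        using less.prems(2) W unfolding u univ_embed_mult
        by (intro primeD(3)[OF M] univ_embed_in_poly_ring) auto
      moreover have "degree p > 0"
      proof (rule ccontr)
        assume "\<not> ?thesis"
        then obtain a where "p = [:a:]" by (metis degree_eq_zeroE gr0I)
        then show False using p unfolding N_def rpoly_def by (auto simp: map_poly_pCons)
      qed
      then have "u \<noteq> 0" "degree u < degree g"
        using less.prems(1) unfolding u by (auto simp: degree_mult_eq)
      ultimately show ?case using less.hyps by blast
    qed
    moreover obtain u where "q = u * p" using dvd[OF q] by (metis dvdE mult.commute)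
    ultimately show ?thesis
      using W univ_embed_in_poly_ring by (auto simp: univ_embed_mult intro!: idealD(4)[OF idM])
  qed
  \<comment> \<open>So \<open>\<beta>\<close> is a generic point of the part of \<open>M\<close> in
    \<open>v\<close> alone, and the other coordinates can be added.\<close>
  have "ev (\<lambda>_. \<beta>) f = 0 \<longleftrightarrow> f \<in> M" if f: "f \<in> poly_ring {v}" for f
    using poly_ring_singleton[OF f] Mvan vanM by (metis ev_univ_embed)
  from generic_point_extend[OF W(1) _ M this] W obtain \<xi> where
    \<xi>: "\<And>w. w \<in> {v} \<Longrightarrow> \<xi> w = \<beta>" "\<And>f. f \<in> poly_ring W \<Longrightarrow> ev \<xi> f = 0 \<longleftrightarrow> f \<in> M"
    by (metis empty_subsetI insert_subset)
  show ?thesis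
    using \<xi> JM idealD(1)[OF J] by (intro that[of \<xi>]) auto
qed

text \<open>Otherwise every transcendental number would be the \<open>v\<close>-coordinate of a zero
  of \<open>J\<close>, and these numbers are uncountably many.\<close>

lemma countable_coordinate_imp_univ_embed:
  assumes W: "finite W" "v \<in> W" and J: "ideal_on (poly_ring W) J"
    and cnt: "countable C" and C: "\<And>\<xi>. (\<And>f. f \<in> J \<Longrightarrow> ev \<xi> f = 0) \<Longrightarrow> \<xi> v \<in> C"
  obtains q where "q \<noteq> 0" "univ_embed v q \<in> J"
proof -
  define Alg where "Alg = (\<Union>q\<in>-{0}. {z. rpoly q z = 0})"
  have "surj (Poly :: rat list \<Rightarrow> _)" by (metis Poly_coeffs surjI)
  then have "countable (UNIV :: rat poly set)" by (metis countable_image uncountable_def countableI_type)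
  then have "countable Alg"
    unfolding Alg_def using countable_subset[OF subset_UNIV] finite_rpoly_roots
    by (intro countable_UN) (auto intro: countable_finite)
  then obtain t where t: "t \<notin> Alg \<union> C"
    using cnt uncountable_UNIV_complex by (metis UNIV_eq_I countable_Un)
  have "\<exists>q. q \<noteq> 0 \<and> univ_embed v q \<in> J"
  proof (rule ccontr)
    assume no: "\<not> ?thesis"
    \<comment> \<open>Under \<open>no\<close> the only \<open>q\<close> to check is 0. The second
      alternative in \<open>zero_above_root\<close> holds because \<open>t\<close> is
      transcendental.\<close>
    have "rpoly q t = 0" if "univ_embed v q \<in> J" for q
      using no that by (cases "q = 0") auto
    moreover have "(\<exists>q. q \<noteq> 0 \<and> univ_embed v q \<in> J) \<or> (\<forall>q. rpoly q t = 0 \<longrightarrow> q = 0)"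
      using t unfolding Alg_def by auto
    ultimately obtain \<xi> where "\<xi> v = t" "\<And>f. f \<in> J \<Longrightarrow> ev \<xi> f = 0"
      using zero_above_root[OF W J, of t] by blast
    then show False using C t by auto
  qed
  then show ?thesis using that by blast
qed

section \<open>The polynomials \<open>T\<^sub>i\<close>\<close>

lemma ideal_in_superset: "S \<subseteq> ideal_in V S"
proof
  fix f assume "f \<in> S"
  then show "f \<in> ideal_in V S"
    unfolding ideal_in_def
    by (auto simp: mvars_def intro!: exI[of _ "{f}"] exI[of _ "\<lambda>_. 1"])
qed

lemma ev_ideal_in: "(\<And>f. f \<in> S \<Longrightarrow> ev \<xi> f = 0) \<Longrightarrow> p \<in> ideal_in V S \<Longrightarrow> ev \<xi> p = 0"
  unfolding ideal_in_def by (auto simp: ev_sum ev_mult subset_iff intro!: sum.neutral)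

lemma ideal_on_ideal_in:
  assumes "S \<subseteq> poly_ring V"
  shows "ideal_on (poly_ring V) (ideal_in V S)"
proof -
  note R = subringD[OF subring_poly_ring[of V]]
  have ideal_in_iff: "p \<in> ideal_in V S \<longleftrightarrow>
      (\<exists>F c. finite F \<and> F \<subseteq> S \<and> (\<forall>f\<in>F. c f \<in> poly_ring V) \<and> p = (\<Sum>f\<in>F. c f * f))" for p
    unfolding ideal_in_def poly_ring_def by simp
  show ?thesis
    unfolding ideal_on_def
  proof (intro conjI ballI)
    show "ideal_in V S \<subseteq> poly_ring V"
      using assms
      by (auto simp: ideal_in_iff subset_iff intro!: subring_sum[OF subring_poly_ring] R(5))
    show "0 \<in> ideal_in V S" unfolding ideal_in_iff by (intro exI[of _ "{}"]) auto
  next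
    fix p q assume "p \<in> ideal_in V S" "q \<in> ideal_in V S"
    then obtain F c G b where
      F: "finite F" "F \<subseteq> S" "\<And>f. f \<in> F \<Longrightarrow> c f \<in> poly_ring V" "p = (\<Sum>f\<in>F. c f * f)" and
      G: "finite G" "G \<subseteq> S" "\<And>f. f \<in> G \<Longrightarrow> b f \<in> poly_ring V" "q = (\<Sum>f\<in>G. b f * f)"
      unfolding ideal_in_iff by blast
    \<comment> \<open>\<open>ideal_in\<close> allows one coefficient per generator, so both
      combinations are padded with zeros to \<open>F \<union> G\<close> before being added.\<close>
    define a where "a f = (if f \<in> F then c f else 0) + (if f \<in> G then b f else 0)" for f
    have "p = (\<Sum>f\<in>F \<union> G. (if f \<in> F then c f else 0) * f)"
      unfolding F(4) using F(1) G(1) by (intro sum.mono_neutral_cong_left) auto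
    moreover have "q = (\<Sum>f\<in>F \<union> G. (if f \<in> G then b f else 0) * f)"
      unfolding G(4) using F(1) G(1) by (intro sum.mono_neutral_cong_left) auto
    ultimately have "p + q = (\<Sum>f\<in>F \<union> G. a f * f)"
      unfolding a_def by (simp add: distrib_right sum.distrib)
    moreover have "\<forall>f\<in>F \<union> G. a f \<in> poly_ring V" unfolding a_def using F G R by auto
    ultimately show "p + q \<in> ideal_in V S"
      unfolding ideal_in_iff using F(1,2) G(1,2) by (intro exI[of _ "F \<union> G"] exI[of _ a]) auto
  next
    fix a p assume a: "a \<in> poly_ring V" and "p \<in> ideal_in V S"
    then obtain F c where
      F: "finite F" "F \<subseteq> S" "\<And>f. f \<in> F \<Longrightarrow> c f \<in> poly_ring V" "p = (\<Sum>f\<in>F. c f * f)"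
      unfolding ideal_in_iff by blast
    then show "a * p \<in> ideal_in V S"
      unfolding ideal_in_iff using a R(5)
      by (intro exI[of _ F] exI[of _ "\<lambda>f. a * c f"]) (auto simp: sum_distrib_left mult.assoc)
  qed
qed

section \<open>Zeros of elimination ideals\<close>

lemma elim_ideal_poly_ring: "elim_ideal P n i \<subseteq> poly_ring {..<i}"
  unfolding elim_ideal_def poly_ring_def by auto

lemma map_in_zeros_in:
  assumes "S \<subseteq> poly_ring {..<i}" "\<And>f. f \<in> S \<Longrightarrow> ev \<xi> f = 0"
  shows "map \<xi> [0..<i] \<in> zeros_in i S"
proof -
  have "ev ((!) (map \<xi> [0..<i])) f = ev \<xi> f" if "f \<in> S" for f
    using assms(1) that by (intro ev_cong[of f "{..<i}"]) (auto simp: poly_ring_def)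
  then show ?thesis using assms(2) unfolding zeros_in_def by (auto simp: meval_eq_ev)
qed

lemma zeros_in_elim_ideal_self:
  assumes "\<forall>f\<in>P. mvars f \<subseteq> {..<n}"
  shows "zeros_in n (elim_ideal P n n) = zeros_in n P"
proof -
  have "P \<subseteq> elim_ideal P n n"
    using assms ideal_in_superset[of P] unfolding elim_ideal_def by auto
  moreover have "meval f xs = 0"
    if "f \<in> elim_ideal P n n" "\<And>g. g \<in> P \<Longrightarrow> meval g xs = 0" for f xs
    using that ev_ideal_in[of P "(!) xs" f] unfolding elim_ideal_def meval_eq_ev by auto
  ultimately show ?thesis unfolding zeros_in_def by blast
qed

lemma take_in_zeros_in_elim_ideal:
  assumes "xs \<in> zeros_in (Suc i) (elim_ideal P n (Suc i))"
  shows "take i xs \<in> zeros_in i (elim_ideal P n i)"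
proof -
  have "meval f (take i xs) = 0" if f: "f \<in> elim_ideal P n i" for f
  proof -
    have "mvars f \<subseteq> {..<i}" using f unfolding elim_ideal_def by auto
    then have "meval f (take i xs) = meval f xs"
      unfolding meval_eq_ev by (intro ev_cong[of f "{..<i}"]) auto
    moreover have "f \<in> elim_ideal P n (Suc i)" using f unfolding elim_ideal_def by force
    ultimately show ?thesis using assms unfolding zeros_in_def by auto
  qed
  then show ?thesis using assms unfolding zeros_in_def by auto
qed

text \<open>Zeros of an elimination ideal are not assumed to lift to zeros of \<open>P\<close>.
  Instead, the ideal of \<open>P\<close> contains a nonzero polynomial in each single variable,
  which confines every coordinate to finitely many roots.\<close>

lemma finite_zeros_in_elim_ideal:
  assumes P: "\<forall>f\<in>P. mvars f \<subseteq> {..<n}" and fin: "finite (zeros_in n P)" and i: "i \<le> n"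
  shows "finite (zeros_in i (elim_ideal P n i))"
proof -
  have PR: "P \<subseteq> poly_ring {..<n}" using P unfolding poly_ring_def by auto
  have "\<exists>q. q \<noteq> 0 \<and> univ_embed j q \<in> ideal_in {..<n} P" if "j < n" for j
  proof (rule countable_coordinate_imp_univ_embed[of "{..<n}" j])
    show "ideal_on (poly_ring {..<n}) (ideal_in {..<n} P)" using PR by (rule ideal_on_ideal_in)
    show "countable ((\<lambda>xs. xs ! j) ` zeros_in n P)" using fin by (simp add: countable_finite)
    fix \<xi> assume "\<And>f. f \<in> ideal_in {..<n} P \<Longrightarrow> ev \<xi> f = 0"
    then have "map \<xi> [0..<n] \<in> zeros_in n P"
      using ideal_in_superset[of P] by (intro map_in_zeros_in[OF PR]) auto
    then have "map \<xi> [0..<n] ! j \<in> (\<lambda>xs. xs ! j) ` zeros_in n P" by (rule imageI)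
    then show "\<xi> j \<in> (\<lambda>xs. xs ! j) ` zeros_in n P" using that by simp
  qed (use that in auto)
  then obtain q where
    q: "\<And>j. j < n \<Longrightarrow> q j \<noteq> 0" "\<And>j. j < n \<Longrightarrow> univ_embed j (q j) \<in> ideal_in {..<n} P"
    by metis
  define X where "X = (\<Union>j<n. {z. rpoly (q j) z = 0})"
  have "zeros_in i (elim_ideal P n i) \<subseteq> {xs. set xs \<subseteq> X \<and> length xs = i}"
  proof safe
    fix xs z assume xs: "xs \<in> zeros_in i (elim_ideal P n i)" and "z \<in> set xs"
    then obtain j where j: "j < i" "z = xs ! j"
      unfolding zeros_in_def by (auto simp: in_set_conv_nth)
    \<comment> \<open>A polynomial in variable \<open>j\<close> alone survives the elimination
      because \<open>j < i\<close>.\<close>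
    then have "univ_embed j (q j) \<in> elim_ideal P n i"
      using q i univ_embed_in_poly_ring[of j "{..<i}"] unfolding elim_ideal_def poly_ring_def by auto
    then have "rpoly (q j) z = 0"
      using xs j unfolding zeros_in_def meval_eq_ev by (auto simp: ev_univ_embed)
    then show "z \<in> X" using i j unfolding X_def by auto
  next
    fix xs assume "xs \<in> zeros_in i (elim_ideal P n i)"
    then show "length xs = i" unfolding zeros_in_def by auto
  qed
  moreover have "finite X" unfolding X_def using q finite_rpoly_roots by auto
  ultimately show ?thesis using finite_lists_length_eq finite_subset by blast
qed

text \<open>The value that \<open>lin_form\<close> prescribes for the auxiliary coordinate; the
  weight at \<open>j = 0\<close> is an empty product, that is 1.\<close>

definition lin_val :: "(nat \<Rightarrow> rat) \<Rightarrow> nat \<Rightarrow> complex list \<Rightarrow> complex" where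
  "lin_val s i xs = (\<Sum>j<i. of_rat (\<Prod>k\<in>{1..j}. s k) * xs ! j)"

text \<open>The zeros of the ideal defining \<open>T\<close> are zeros of the elimination ideal with
  the value of the linear form adjoined as coordinate \<open>n\<close>. Only finitely many values
  occur, so the ideal contains a nonzero polynomial in that coordinate, and
  \<open>zero_above_root\<close> lifts every root of \<open>T\<close> to a zero.\<close>

lemma T_roots:
  assumes P: "\<forall>f\<in>P. mvars f \<subseteq> {..<n}" and fin: "finite (zeros_in n P)" and i: "i \<le> n"
    and T: "is_T P n s i T"
  shows "rpoly T z = 0 \<longleftrightarrow> z \<in> lin_val s i ` zeros_in i (elim_ideal P n i)"
proof -
  define W where "W = insert n {..<i}"
  define S where "S = elim_ideal P n i \<union> {lin_form s n i}"
  define J where "J = ideal_in W S"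
  have TJ: "univ_embed n q \<in> J \<longleftrightarrow> T dvd q" for q
    using T unfolding is_T_def J_def W_def S_def by blast
  have ev_lin: "ev \<xi> (lin_form s n i) = \<xi> n - lin_val s i (map \<xi> [0..<i])" for \<xi>
    unfolding lin_form_def lin_val_def by (simp add: ev.e_minus ev_sum ev_mult)
  have "lin_form s n i \<in> poly_ring W"
    unfolding lin_form_def W_def
    by (intro subringD(6,5)[OF subring_poly_ring] subring_sum[OF subring_poly_ring]
        mconst_in_poly_ring mvar_in_poly_ring) auto
  moreover have "poly_ring {..<i} \<subseteq> poly_ring W" unfolding W_def by (intro poly_ring_mono) auto
  ultimately have SR: "S \<subseteq> poly_ring W"
    using elim_ideal_poly_ring[of P n i] unfolding S_def by auto
  have idJ: "ideal_on (poly_ring W) J" unfolding J_def using SR by (rule ideal_on_ideal_in)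
  have W: "finite W" "n \<in> W" unfolding W_def by auto
  have zero: "\<xi> n \<in> lin_val s i ` zeros_in i (elim_ideal P n i)"
    if "\<And>f. f \<in> J \<Longrightarrow> ev \<xi> f = 0" for \<xi>
  proof -
    have *: "ev \<xi> f = 0" if "f \<in> S" for f
      using that \<open>\<And>f. f \<in> J \<Longrightarrow> ev \<xi> f = 0\<close> ideal_in_superset[of S W] unfolding J_def by auto
    then have "map \<xi> [0..<i] \<in> zeros_in i (elim_ideal P n i)"
      unfolding S_def by (intro map_in_zeros_in[OF elim_ideal_poly_ring]) auto
    moreover have "\<xi> n = lin_val s i (map \<xi> [0..<i])"
      using *[of "lin_form s n i"] ev_lin unfolding S_def by auto
    ultimately show ?thesis by blast
  qed
  show ?thesis
  proof
    assume z: "rpoly T z = 0"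
    have "countable (lin_val s i ` zeros_in i (elim_ideal P n i))"
      using finite_zeros_in_elim_ideal[OF P fin i] by (intro countable_finite) auto
    then obtain q where "q \<noteq> 0" "univ_embed n q \<in> J"
      using zero by (rule countable_coordinate_imp_univ_embed[OF W idJ]) blast
    then have "\<exists>q. q \<noteq> 0 \<and> univ_embed n q \<in> J" by blast
    moreover have "rpoly q z = 0" if "univ_embed n q \<in> J" for q
      using that z TJ by (auto simp: rpoly_mult elim!: dvdE)
    ultimately obtain \<xi> where "\<xi> n = z" "\<And>f. f \<in> J \<Longrightarrow> ev \<xi> f = 0"
      using zero_above_root[OF W idJ] by metis
    then show "z \<in> lin_val s i ` zeros_in i (elim_ideal P n i)" using zero by blast
  next
    assume "z \<in> lin_val s i ` zeros_in i (elim_ideal P n i)"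
    then obtain xs where xs: "xs \<in> zeros_in i (elim_ideal P n i)" "z = lin_val s i xs" by auto
    \<comment> \<open>Index \<open>n\<close> is free for the auxiliary coordinate, as the
      elimination ideal involves only indices below \<open>i\<close>, and
      \<open>i \<le> n\<close>.\<close>
    define \<xi> where "\<xi> = (\<lambda>j. if j = n then z else xs ! j)"
    have "ev \<xi> f = 0" if "f \<in> elim_ideal P n i" for f
    proof -
      have "ev \<xi> f = ev ((!) xs) f"
        using that i elim_ideal_poly_ring[of P n i]
        by (intro ev_cong[of f "{..<i}"]) (auto simp: poly_ring_def \<xi>_def)
      then show ?thesis using xs that unfolding zeros_in_def meval_eq_ev by auto
    qed
    moreover have "lin_val s i (map \<xi> [0..<i]) = z"
      unfolding xs(2) lin_val_def using i by (intro sum.cong) (auto simp: \<xi>_def)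
    then have "ev \<xi> (lin_form s n i) = 0" unfolding ev_lin by (simp add: \<xi>_def)
    ultimately have "\<And>f. f \<in> S \<Longrightarrow> ev \<xi> f = 0" unfolding S_def by auto
    moreover have "univ_embed n T \<in> J" unfolding TJ by simp
    ultimately have "ev \<xi> (univ_embed n T) = 0" unfolding J_def by (rule ev_ideal_in)
    then show "rpoly T z = 0" unfolding ev_univ_embed \<xi>_def by simp
  qed
qed

section \<open>Separation of the values of the linear forms\<close>

lemma cnorm_of_rat_mult: "a \<ge> 0 \<Longrightarrow> cnorm (of_rat a * z) = of_rat a * cnorm z"
proof -
  assume "a \<ge> 0"
  moreover have "(of_rat a :: complex) = of_real (of_rat a)"
    by (cases a) (simp add: of_rat_rat)
  ultimately show ?thesis
    unfolding cnorm_def by (simp add: abs_mult max_mult_distrib_left)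
qed

lemma cnorm_add: "cnorm (x + y) \<le> cnorm x + cnorm y"
  unfolding cnorm_def by auto

lemma cnorm_minus: "cnorm (- x) = cnorm x"
  unfolding cnorm_def by auto

lemma cnorm_diff: "cnorm (x - y) \<le> cnorm x + cnorm y"
  using cnorm_add[of x "- y"] by (simp add: cnorm_minus)

lemma cnorm_diff_ge: "cnorm (x + y) \<ge> cnorm x - cnorm y"
  using cnorm_diff[of "x + y" y] by simp

lemma lin_val_Suc:
  assumes "length xs = Suc i"
  shows "lin_val s (Suc i) xs =
    lin_val s i (take i xs) + of_rat (\<Prod>k\<in>{1..i}. s k) * xs ! i"
  unfolding lin_val_def by simp

section \<open>Comparing the roots of the representation with the zeros of the system\<close>

theorem mainTheorem1:
  fixes P :: "mpoly set" and n :: nat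
    and d r s :: "nat \<Rightarrow> rat" and T :: "nat \<Rightarrow> rat poly"
  assumes n_pos: "n \<ge> 1"
    and P_fin: "finite P"
    and P_vars: "\<forall>f\<in>P. mvars f \<subseteq> {..<n}"
    and zero_dim: "finite (zeros_in n P)"
    and d_pos: "\<forall>i\<in>{1..n}. d i > 0"
    and r_pos: "\<forall>i\<in>{1..n}. r i > 0"
    and s_pos: "\<forall>i\<in>{1..n-1}. s i > 0"
    and C1_D: "\<forall>i\<in>{1..n}. \<forall>\<eta> \<alpha> \<beta>.
                 \<eta> \<in> zeros_in (i - 1) (elim_ideal P n (i - 1)) \<and>
                 \<eta> @ [\<alpha>] \<in> zeros_in i (elim_ideal P n i) \<and>
                 \<eta> @ [\<beta>] \<in> zeros_in i (elim_ideal P n i) \<and> \<alpha> \<noteq> \<beta>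
                 \<longrightarrow> of_rat (d i) < cnorm (\<alpha> - \<beta>) / 2"
    and C1_d: "\<forall>i\<in>{2..n}. d i < d (i - 1) / (2 * s (i - 1))"
    and C2: "\<forall>i\<in>{1..n}. \<forall>xs\<in>zeros_in i (elim_ideal P n i).
                 of_rat (r i) > 2 * cnorm (xs ! (i - 1))"
    and C3: "\<forall>i\<in>{1..n-1}. s i \<le> d i / r (i + 1)"
    and T_def: "\<forall>i\<in>{1..n}. is_T P n s i (T i)"
  shows "lur_roots n T s d = zeros_in n P"
proof -
  define Z where "Z i = zeros_in i (elim_ideal P n i)" for i
  \<comment> \<open>\<open>\<sigma> i\<close> is the weight of the coordinate with 0-based index
    \<open>i\<close>; \<open>E i\<close>, built from \<open>\<sigma> (i - 1)\<close>, is the bound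
    on consecutive roots in \<open>lur_roots\<close>.\<close>
  define \<sigma> where "\<sigma> i = (\<Prod>j\<in>{1..i}. s j)" for i
  define E where "E i = \<sigma> (i - 1) * d i" for i
  have Zn: "Z n = zeros_in n P"
    unfolding Z_def using zeros_in_elim_ideal_self[OF P_vars] .
  have Zlen: "length xs = i" if "xs \<in> Z i" for xs i
    using that unfolding Z_def zeros_in_def by auto
  have Ztake: "take i xs \<in> Z i" if "xs \<in> Z (Suc i)" for xs i
    using that take_in_zeros_in_elim_ideal unfolding Z_def by auto
  have \<sigma>_Suc: "\<sigma> (Suc i) = \<sigma> i * s (Suc i)" for i unfolding \<sigma>_def by simp
  have \<sigma>_pos: "\<sigma> i > 0" if "i < n" for i
    unfolding \<sigma>_def using s_pos that by (intro prod_pos) auto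
  have L_Suc: "lin_val s (Suc i) xs = lin_val s i (take i xs) + of_rat (\<sigma> i) * xs ! i"
    if "xs \<in> Z (Suc i)" for i xs
    using lin_val_Suc[OF Zlen[OF that]] unfolding \<sigma>_def .
  have roots: "poly (map_poly of_rat (T i)) z = 0 \<longleftrightarrow> z \<in> lin_val s i ` Z i"
    if "i \<in> {1..n}" for i z
    using T_roots[OF P_vars zero_dim, of i s "T i" z] T_def that unfolding rpoly_def Z_def by auto
  \<comment> \<open>This is \<open>C1_d\<close> at index \<open>i + 1\<close>, multiplied by
    \<open>2 * s i\<close> and by \<open>\<sigma> (i - 1)\<close>.\<close>
  have E_dec: "2 * E (Suc i) < E i" if i: "1 \<le> i" "i < n" for i
  proof -
    obtain k where k: "i = Suc k" using i by (cases i) auto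
    have s: "s i > 0" using s_pos i by auto
    have "d (Suc i) < d i / (2 * s i)" using C1_d i by (auto dest: bspec[of _ _ "Suc i"])
    then have "2 * s i * d (Suc i) < d i" using s by (simp add: field_simps)
    then have "\<sigma> k * (2 * s i * d (Suc i)) < \<sigma> k * d i"
      using \<sigma>_pos[of k] i k by (intro mult_strict_left_mono) auto
    then show ?thesis unfolding E_def by (simp add: k \<sigma>_Suc algebra_simps)
  qed
  \<comment> \<open>\<open>C3\<close>, scaled by \<open>\<sigma> (i - 1)\<close>, gives
    \<open>\<sigma> i * r (i + 1) \<le> E i\<close>, while \<open>C2\<close> keeps the new
    coordinate below half of \<open>r (i + 1)\<close>.\<close>
  have last: "cnorm (of_rat (\<sigma> i) * xs ! i) < of_rat (E i) / 2"
    if i: "1 \<le> i" "i < n" and xs: "xs \<in> Z (Suc i)" for i xs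
  proof -
    obtain k where k: "i = Suc k" using i by (cases i) auto
    have "s i \<le> d i / r (Suc i)" "r (Suc i) > 0" using C3 r_pos i by auto
    then have "s i * r (Suc i) \<le> d i" by (simp add: field_simps)
    then have "\<sigma> k * (s i * r (Suc i)) \<le> \<sigma> k * d i"
      using \<sigma>_pos[of k] i k by (intro mult_left_mono) auto
    then have "\<sigma> i * r (Suc i) \<le> E i" unfolding E_def by (simp add: k \<sigma>_Suc algebra_simps)
    then have le: "real_of_rat (\<sigma> i) * of_rat (r (Suc i)) \<le> of_rat (E i)"
      by (metis of_rat_mult of_rat_less_eq)
    have "2 * cnorm (xs ! i) < of_rat (r (Suc i))"
      using C2 i xs unfolding Z_def by (auto dest!: bspec[of _ _ "Suc i"])
    then have "real_of_rat (\<sigma> i) * (2 * cnorm (xs ! i)) < of_rat (\<sigma> i) * of_rat (r (Suc i))"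
      using \<sigma>_pos[of i] i by (intro mult_strict_left_mono) auto
    then have "2 * (of_rat (\<sigma> i) * cnorm (xs ! i)) < of_rat (E i)" using le by linarith
    then show ?thesis using \<sigma>_pos[of i] i by (simp add: cnorm_of_rat_mult)
  qed
  \<comment> \<open>Equal prefixes: only the last terms differ, and \<open>C1_D\<close> separates
    them. Different prefixes: the last terms take less than \<open>E i\<close> from a gap above
    \<open>2 * E i\<close>, and the rest exceeds \<open>2 * E (i + 1)\<close>.\<close>
  have sep: "2 * of_rat (E i) < cnorm (lin_val s i xs - lin_val s i ys)"
    if "i \<in> {1..n}" "xs \<in> Z i" "ys \<in> Z i" "xs \<noteq> ys" for i xs ys
    using that
  proof (induction i arbitrary: xs ys)
    case 0
    then show ?case by simp
  next
    case (Suc i)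
    note xs = Suc.prems(2) and ys = Suc.prems(3)
    have split: "zs = take i zs @ [zs ! i]" if "zs \<in> Z (Suc i)" for zs
      using Zlen[OF that] by (metis lessI take_Suc_conv_app_nth take_all order_refl)
    have diff: "lin_val s (Suc i) xs - lin_val s (Suc i) ys =
        (lin_val s i (take i xs) - lin_val s i (take i ys)) +
        of_rat (\<sigma> i) * (xs ! i - ys ! i)"
      by (simp add: L_Suc[OF xs] L_Suc[OF ys] algebra_simps)
    show ?case
    proof (cases "take i xs = take i ys")
      case True
      then have ne: "xs ! i \<noteq> ys ! i" using split[OF xs] split[OF ys] Suc.prems(4) by metis
      have "take i xs \<in> Z i \<and> take i xs @ [xs ! i] \<in> Z (Suc i) \<and> take i xs @ [ys ! i] \<in> Z (Suc i)"
        using Ztake[OF xs] split[OF xs] split[OF ys] xs ys True by metis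
      then have "of_rat (d (Suc i)) < cnorm (xs ! i - ys ! i) / 2"
        using bspec[OF C1_D Suc.prems(1)] ne unfolding Z_def by auto
      then have "real_of_rat (\<sigma> i) * (2 * of_rat (d (Suc i))) <
          of_rat (\<sigma> i) * cnorm (xs ! i - ys ! i)"
        using \<sigma>_pos[of i] Suc.prems(1) by (intro mult_strict_left_mono) auto
      also have "\<dots> = cnorm (lin_val s (Suc i) xs - lin_val s (Suc i) ys)"
        using \<sigma>_pos[of i] Suc.prems(1) unfolding diff True by (simp add: cnorm_of_rat_mult)
      finally show ?thesis unfolding E_def by (simp add: of_rat_mult mult_ac)
    next
      case False
      \<comment> \<open>At \<open>i = 0\<close> both prefixes would be empty; so \<open>last\<close>
        and the induction hypothesis apply.\<close>
      then have i: "1 \<le> i" "i < n" using Suc.prems(1) by (auto simp: Suc_le_eq intro: gr0I)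
      then have IH: "2 * of_rat (E i) < cnorm (lin_val s i (take i xs) - lin_val s i (take i ys))"
        using Suc.IH[OF _ Ztake[OF xs] Ztake[OF ys] False] by simp
      have "cnorm (of_rat (\<sigma> i) * (xs ! i - ys ! i)) < of_rat (E i)"
        using last[OF i xs] last[OF i ys]
          cnorm_diff[of "of_rat (\<sigma> i) * xs ! i" "of_rat (\<sigma> i) * ys ! i"]
        by (simp add: right_diff_distrib)
      moreover have "2 * real_of_rat (E (Suc i)) < of_rat (E i)"
        using E_dec[OF i] by (metis of_rat_less of_rat_mult of_rat_numeral_eq)
      ultimately show ?thesis
        unfolding diff
        using IH cnorm_diff_ge[of "lin_val s i (take i xs) - lin_val s i (take i ys)"
            "of_rat (\<sigma> i) * (xs ! i - ys ! i)"] by linarith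
    qed
  qed
  \<comment> \<open>Dividing consecutive differences by their weights recovers the coordinates from
    the values of the linear forms.\<close>
  define pt where "pt \<alpha> = map (\<lambda>k. if k = 0 then \<alpha> 1
      else (\<alpha> (k + 1) - \<alpha> k) / of_rat (\<sigma> k)) [0..<n]" for \<alpha> :: "nat \<Rightarrow> complex"
  have Ztakes: "take i xs \<in> Z i" if xs: "xs \<in> Z n" and i: "i \<le> n" for xs i
    using i
  proof (induction rule: inc_induct)
    case base
    then show ?case using xs Zlen[OF xs] by simp
  next
    case (step m)
    then show ?case using Ztake[of "take (Suc m) xs" m] by (simp add: min_def)
  qed
  have pt_eq: "pt \<alpha> = xs"
    if xs: "xs \<in> Z n" and \<alpha>: "\<And>i. i \<in> {1..n} \<Longrightarrow> \<alpha> i = lin_val s i (take i xs)" for \<alpha> xs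
  proof (rule nth_equalityI)
    show "length (pt \<alpha>) = length xs" unfolding pt_def using Zlen[OF xs] by simp
    fix k assume "k < length (pt \<alpha>)"
    then have k: "k < n" unfolding pt_def by simp
    have step: "lin_val s (Suc k) (take (Suc k) xs) =
        lin_val s k (take k xs) + of_rat (\<sigma> k) * xs ! k"
      using L_Suc[OF Ztakes[OF xs]] k by (simp add: min_def)
    show "pt \<alpha> ! k = xs ! k"
    proof (cases "k = 0")
      case True
      then show ?thesis
        using k \<alpha>[of 1] step unfolding pt_def by (simp add: lin_val_def \<sigma>_def)
    next
      case False
      then show ?thesis
        using k \<alpha>[of k] \<alpha>[of "Suc k"] step \<sigma>_pos[OF k] unfolding pt_def by simp
    qed
  qed
  have lur: "xs \<in> lur_roots n T s d \<longleftrightarrow> (\<exists>\<alpha>. xs = pt \<alpha> \<and>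
      (\<forall>i\<in>{1..n}. \<alpha> i \<in> lin_val s i ` Z i) \<and>
      (\<forall>i\<in>{1..n-1}. cnorm (\<alpha> (Suc i) - \<alpha> i) < of_rat (E i)))" for xs
    unfolding lur_roots_def pt_def \<sigma>_def E_def using roots by simp
  have "xs \<in> Z n" if xs: "xs \<in> lur_roots n T s d" for xs
  proof -
    obtain \<alpha> where \<alpha>: "xs = pt \<alpha>" "\<And>i. i \<in> {1..n} \<Longrightarrow> \<alpha> i \<in> lin_val s i ` Z i"
      "\<And>i. i \<in> {1..n-1} \<Longrightarrow> cnorm (\<alpha> (Suc i) - \<alpha> i) < of_rat (E i)"
      using xs unfolding lur by blast
    \<comment> \<open>Each root is traced back to a zero at its own level; nothing relates these
      zeros to each other yet.\<close>
    have "\<forall>i\<in>{1..n}. \<exists>x. x \<in> Z i \<and> \<alpha> i = lin_val s i x" using \<alpha>(2) by blast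
    from bchoice[OF this] obtain w where
      w: "\<And>i. i \<in> {1..n} \<Longrightarrow> w i \<in> Z i" "\<And>i. i \<in> {1..n} \<Longrightarrow> \<alpha> i = lin_val s i (w i)"
      by blast
    \<comment> \<open>\<open>sep\<close> conflicts with the triangle inequality: the values at the
      two candidate prefixes differ by the jump between roots minus the newly added term.\<close>
    have chain: "take i (w (Suc i)) = w i" if i: "1 \<le> i" "i < n" for i
    proof (rule ccontr)
      assume ne: "\<not> ?thesis"
      have wZ: "w (Suc i) \<in> Z (Suc i)" using w(1) i by simp
      let ?x = "lin_val s i (take i (w (Suc i)))" and ?t = "of_rat (\<sigma> i) * w (Suc i) ! i"
      have "2 * of_rat (E i) < cnorm (?x - lin_val s i (w i))"
        using sep[OF _ Ztake[OF wZ] w(1) ne] i by simp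
      also have "?x - lin_val s i (w i) = (\<alpha> (Suc i) - \<alpha> i) - ?t"
        using w(2)[of i] w(2)[of "Suc i"] L_Suc[OF wZ] i by simp
      also have "cnorm \<dots> \<le> cnorm (\<alpha> (Suc i) - \<alpha> i) + cnorm ?t" by (rule cnorm_diff)
      also have "\<dots> < of_rat (E i) + of_rat (E i) / 2"
        using \<alpha>(3)[of i] last[OF i wZ] i by (intro add_strict_mono) auto
      finally have "real_of_rat (E i) < 0" by simp
      moreover have "E i > 0"
        unfolding E_def using \<sigma>_pos[of "i - 1"] d_pos i by auto
      ultimately show False by simp
    qed
    \<comment> \<open>Going down from level \<open>n\<close>, all chosen zeros turn out to be
      prefixes of the single point \<open>w n\<close>.\<close>
    have "take i (w n) = w i" if "i \<le> n" "1 \<le> i" for i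
      using that
    proof (induction rule: inc_induct)
      case base
      then show ?case using Zlen[of "w n" n] w(1) n_pos by simp
    next
      case (step m)
      have "take m (w n) = take m (take (Suc m) (w n))" by (simp add: min_def)
      also have "\<dots> = take m (w (Suc m))" using step by simp
      also have "\<dots> = w m" using chain step by simp
      finally show ?case .
    qed
    then have "pt \<alpha> = w n" using w n_pos by (intro pt_eq) auto
    then show ?thesis using w(1)[of n] \<alpha>(1) n_pos by simp
  qed
  moreover have "xs \<in> lur_roots n T s d" if xs: "xs \<in> Z n" for xs
  proof -
    \<comment> \<open>Conversely, a zero supplies the roots as the values on its prefixes.\<close>
    define \<alpha> where "\<alpha> i = lin_val s i (take i xs)" for i
    have "\<alpha> i \<in> lin_val s i ` Z i" if "i \<in> {1..n}" for i
      using Ztakes[OF xs] that unfolding \<alpha>_def by auto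
    moreover have "cnorm (\<alpha> (Suc i) - \<alpha> i) < of_rat (E i)" if "i \<in> {1..n-1}" for i
    proof -
      have i: "1 \<le> i" "i < n" using that by auto
      have t: "take (Suc i) xs \<in> Z (Suc i)" using Ztakes[OF xs] i by simp
      have "\<alpha> (Suc i) - \<alpha> i = of_rat (\<sigma> i) * take (Suc i) xs ! i"
        unfolding \<alpha>_def L_Suc[OF t] by (simp add: min_def)
      moreover have "cnorm (of_rat (\<sigma> i) * take (Suc i) xs ! i) < of_rat (E i)"
      proof -
        \<comment> \<open>\<open>last\<close> bounds the norm by half of \<open>E i\<close>;
          nonnegativity of the norm makes \<open>E i\<close> positive, so this half lies below
          \<open>E i\<close>.\<close>
        have "cnorm (of_rat (\<sigma> i) * take (Suc i) xs ! i) \<ge> 0" unfolding cnorm_def by simp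
        then show ?thesis using last[OF i t] by linarith
      qed
      ultimately show ?thesis by metis
    qed
    ultimately show ?thesis unfolding lur using pt_eq[OF xs, of \<alpha>] \<alpha>_def by blast
  qed
  ultimately show ?thesis unfolding Zn[symmetric] by blast
qed

end
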